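(* Consider the stochastic first-order method described in the context with proximal function $\phi=\delta_{\{\mathbf z:\|\mathbf z\|_1\le\psi\}}$ (the indicator function of the $\ell_1$-ball of radius $\psi>0$, the same at every iteration) and variance-reduced gradient estimates $G^k$ (with parameters $q_0,m_1,m$) as described in the context, and suppose the standing assumptions in the context hold. Let $\Omega=e^2\log d$, $\eta_k=\eta>0$ for all $k$, and $p_k=1/K$. Then for every $t>0$, $$\begin{aligned}\mathbb E\big[\mathrm{dist}_{\|\cdot\|_\infty}(0,\partial(f+\delta_X)(\mathbf x^{Y+1}))\big]\le{}&\left(L+\frac1\eta+\sqrt{\frac{4\Omega^2L^2q_0}{m}}\right)\psi+\sqrt{\frac{\Omega e^2(\log d)\sigma_\infty^2}{m_1}}\\&+\frac1\psi\left(\frac{\Delta_f}K+\frac{t\,\Omega e^2(\log d)\sigma_\infty^2}{2m_1}+\left(\frac{2t\Omega^2L^2q_0}{m}+\frac L2+\frac1{2t}\right)\psi^2\right).\end{aligned}$$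
   Context: Problem: minimize $f(\mathbf x)=\mathbb E[F(\mathbf x,\zeta)]$ over $\mathbf x\in X$, where $X\subseteq\mathbb R^d$ ($d\ge2$) is nonempty, closed and convex, $\zeta$ is a random vector with values in $\Xi$, $f:\mathbb R^d\to\mathbb R$ is well defined, finite and everywhere differentiable (possibly nonconvex). $\|\cdot\|$ is the Euclidean norm. $F(\cdot,\zeta)$ is everywhere differentiable for every $\zeta\in\Xi$, its gradient $\nabla F(\mathbf x,\zeta)$ can be evaluated (stochastic first-order oracle), and $\mathbb E[\nabla F(\mathbf x,\zeta)]=\nabla f(\mathbf x)$ for all $\mathbf x\in X$. Standing assumptions: (i) $\sigma_\infty^2:=\max_{\mathbf x\in X}\mathbb E[\|\nabla F(\mathbf x,\zeta)-\nabla f(\mathbf x)\|_\infty^2]<\infty$; (ii) for a constant $L\ge0$, $\mathbb E[\|\nabla F(\mathbf x,\zeta)-\nabla F(\mathbf y,\zeta)\|_\infty^2]\le L^2\|\mathbf x-\mathbf y\|_1^2$ for all $\mathbf x,\mathbf y\in X$; (iii) $f(\mathbf x)\ge\underline f$ for all $\mathbf x\in X$, for some $\underline f\in\mathbb R$. Algorithm: choose $\mathbf x^1\in X$ and a positive integer $K$. For $k=1,\dots,K$: form a gradient estimate $G^k$ and set $$\mathbf x^{k+1}=\arg\min_{\mathbf x\in X}\left\{\tfrac12\|\mathbf x-(\mathbf x^k-\eta_kG^k)\|^2+\phi(\mathbf x-\mathbf x^k)\right\}.$$ Output $\mathbf x^{Y+1}$, where $Y$ is a random index, independent of everything else, with $\mathbb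 P[Y=k]=p_k$, $k=1,\dots,K$. Variance-reduced estimate: given positive integers $q_0,m_1,m$, let $m_k=m_1$ if $k\equiv1\pmod{q_0}$ and $m_k=m$ otherwise; with $\zeta_i^k$ i.i.d. copies of $\zeta$ drawn afresh at each iteration (independent of the past), $$G^k=\begin{cases}\frac1{m_k}\sum_{i=1}^{m_k}\nabla F(\mathbf x^k,\zeta_i^k), & k\equiv1\pmod{q_0},\\ \frac1{m_k}\sum_{i=1}^{m_k}\big(\nabla F(\mathbf x^k,\zeta_i^k)-\nabla F(\mathbf x^{k-1},\zeta_i^k)\big)+G^{k-1}, & \text{otherwise.}\end{cases}$$ Notation: $\Delta_f=\mathbb E[f(\mathbf x^1)]-\underline f$. For a set $S$, $\delta_S$ is its indicator function ($0$ on $S$, $+\infty$ off $S$), $\partial$ is the Fréchet subdifferential, so for $\mathbf x\in X$, $\partial(f+\delta_X)(\mathbf x)=\nabla f(\mathbf x)+N_X(\mathbf x)$ with $N_X$ the normal cone, and $\mathrm{dist}_{\|\cdot\|_\infty}(0,S)=\inf\{\|\mathbf v\|_\infty:\mathbf v\in S\}$. *)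

theory Defs
  imports "HOL-Probability.Probability" "HOL-Number_Theory.Cong"
begin

definition l1norm :: "real^'n \<Rightarrow> real" where
  "l1norm x = (\<Sum>i\<in>UNIV. \<bar>x $ i\<bar>)"

text \<open>Only meaningful where \<open>h\<close> is differentiable; every use below is at such a point.\<close>
definition grad :: "(real^'n \<Rightarrow> real) \<Rightarrow> real^'n \<Rightarrow> real^'n" where
  "grad h x = (THE D. GDERIV h x :> D)"

definition delta :: "'a set \<Rightarrow> 'a \<Rightarrow> ereal" where
  "delta S x = (if x \<in> S then 0 else \<infinity>)"

text \<open>Frechet subdifferential of an extended-real-valued function; empty off the domain of \<open>h\<close>.\<close>
definition frechet_subdiff :: "(real^'n \<Rightarrow> ereal) \<Rightarrow> real^'n \<Rightarrow> (real^'n) set" where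
  "frechet_subdiff h x =
     {v. \<bar>h x\<bar> \<noteq> \<infinity> \<and>
         0 \<le> Liminf (at x) (\<lambda>y. (h y - h x - ereal (v \<bullet> (y - x))) / ereal (norm (y - x)))}"

text \<open>Distance from the origin to \<open>S\<close> in the max-norm. The infimum is taken in the reals, so
  \<open>S\<close> has to be nonempty; for the sets \<open>\<partial>(f + \<delta>\<^sub>X)(x)\<close> with \<open>x \<in> X\<close> and \<open>f\<close> differentiable it is,
  since these contain the gradient of \<open>f\<close> at \<open>x\<close>.\<close>
definition dist0_infnorm :: "(real^'n) set \<Rightarrow> real" where
  "dist0_infnorm S = (INF v\<in>S. infnorm v)"

definition prox_step ::
  "(real^'n) set \<Rightarrow> (real^'n \<Rightarrow> ereal) \<Rightarrow> real \<Rightarrow> real^'n \<Rightarrow> real^'n \<Rightarrow> real^'n \<Rightarrow> bool" where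
  "prox_step X \<phi> \<eta> x g x' \<longleftrightarrow>
     is_arg_min (\<lambda>y. ereal (1/2 * (norm (y - (x - \<eta> *\<^sub>R g)))\<^sup>2) + \<phi> (y - x)) (\<lambda>y. y \<in> X) x'"

definition batch :: "nat \<Rightarrow> nat \<Rightarrow> nat \<Rightarrow> nat \<Rightarrow> nat" where
  "batch q0 m1 m k = (if [k = 1] (mod q0) then m1 else m)"

text \<open>The independent sources of randomness: the starting point, the samples \<open>\<zeta>\<^sub>i\<^sup>k\<close>, and the
  output index. An index type is used because these variables have different value types,
  so that their mutual independence has to be stated through the generated sigma-algebras.\<close>
datatype source = Start | Sample nat nat | Output

definition sources :: "nat \<Rightarrow> (nat \<Rightarrow> nat) \<Rightarrow> source set" where
  "sources K b = {Start, Output} \<union> {Sample k i | k i. k \<in> {1..K} \<and> i \<in> {1..b k}}"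

definition source_events ::
  "'w measure \<Rightarrow> 'z measure \<Rightarrow> nat \<Rightarrow> ('w \<Rightarrow> real^'n) \<Rightarrow> (nat \<Rightarrow> nat \<Rightarrow> 'w \<Rightarrow> 'z) \<Rightarrow> ('w \<Rightarrow> nat)
     \<Rightarrow> source \<Rightarrow> 'w set set" where
  "source_events M D K x1 \<zeta> Y s =
     (case s of
        Start \<Rightarrow> sets (vimage_algebra (space M) x1 borel)
      | Sample k i \<Rightarrow> sets (vimage_algebra (space M) (\<zeta> k i) D)
      | Output \<Rightarrow> sets (vimage_algebra (space M) Y (count_space {1..K})))"

end

theory Submission
  imports Defs
begin

text \<open>
  The optimality condition of the proximal step splits into a normal vector of \<open>X\<close> and one of the
  \<open>\<ell>\<^sub>1\<close>-ball; the pairing of the latter with the step is \<open>\<psi>\<close> times its max-norm, and by the descent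
  lemma it is at most \<open>\<eta>\<close> times the decrease of \<open>f\<close> plus \<open>L \<psi>\<^sup>2 / 2\<close> plus \<open>\<psi>\<close> times the max-norm of the
  gradient error. Averaging telescopes the decrease, so only the error remains. The error is a
  martingale between restarts, and the squared max-norm is dominated by a smooth potential, the
  squared \<open>\<ell>\<^sub>2\<^sub>r\<close>-norm shifted away from its singularity at \<open>0\<close>, whose second derivative is at most
  \<open>6 (2 r - 1)\<close> times the squared max-norm once \<open>2\<^sup>r\<^sup>-\<^sup>1 \<ge> d\<close>. Hence second moments of increments add up
  with a factor of order \<open>log d\<close>, which is below \<open>\<Omega>\<^sup>2\<close>.
\<close>

section \<open>A smooth potential for the squared max-norm\<close>

text \<open>The squared max-norm has kinks, so a centred independent increment need not add just its
  own second moment. A smooth substitute must have curvature that is cheap when directions are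
  measured in the max-norm: for the squared \<open>\<ell>\<^sub>2\<^sub>r\<close>-norm it is of
  order \<open>r\<close>, times \<open>d^(1/r)\<close> for the change of norm, which stays bounded
  once \<open>r\<close> is of order \<open>log d\<close>. The shift is needed because the error of
  every restart is built up from \<open>0\<close>; it is sent to \<open>0\<close> only after all
  steps have been summed. Since each step has l1-length at most \<psi>, all recursive corrections
  obey the same second-moment bound. The second obstacle is measure-theoretic. The iterates are
  given pointwise, as minimisers over a set that moves with the iterate, and independence of fresh
  samples is usable only once the iterates are known to be functions of the earlier sources. Hence
  the joint measurability of the gradients and the joint continuity of the proximal map. The target
  quantity, an infimum over an uncountable cone that varies with the point, needs its own
  measurability argument.\<close>

lemma abs_nth_le_infnorm: "\<bar>x $ i\<bar> \<le> infnorm (x :: real^'n)"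
  using component_le_infnorm_cart by blast

lemma infnorm_attained: "\<exists>i. infnorm (x :: real^'n) = \<bar>x $ i\<bar>"
proof -
  have eq: "{\<bar>x $ i\<bar> | i. i \<in> UNIV} = range (\<lambda>i. \<bar>x $ i\<bar>)" by auto
  have "infnorm x = Max (range (\<lambda>i. \<bar>x $ i\<bar>))"
    unfolding infnorm_cart eq by (intro cSup_eq_Max) auto
  moreover have "Max (range (\<lambda>i. \<bar>x $ i\<bar>)) \<in> range (\<lambda>i. \<bar>x $ i\<bar>)"
    by (intro Max_in) auto
  ultimately show ?thesis by (metis (mono_tags, lifting) imageE)
qed

text \<open>Interpolation between exponents without Hoelder. A coordinate with square at least
  \<open>G / 2\<close> can afford the extra factor \<open>2 * u i ^ 2 / G\<close>; each of the
  others contributes at most \<open>(G / 2) ^ (r - 1)\<close>, and the bound on the dimension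
  cancels exactly this power of two. Hence \<open>3 = 2 + 1\<close>.\<close>

lemma power_sum_bound:
  fixes u :: "'n :: finite \<Rightarrow> real"
  assumes r: "r \<ge> 1" and card: "real CARD('n) \<le> 2 ^ (r - 1)"
    and G: "G > 0" and le: "(\<Sum>i\<in>UNIV. u i ^ (2 * r)) \<le> G ^ r"
  shows "(\<Sum>i\<in>UNIV. u i ^ (2 * r - 2)) \<le> 3 * G ^ (r - 1)"
proof -
  obtain k where k: "r = Suc k" using r by (metis Suc_pred' less_eq_Suc_le One_nat_def)
  have termwise: "u i ^ (2 * r - 2) \<le> 2 * u i ^ (2 * r) / G + (G / 2) ^ (r - 1)" for i
  proof -
    define a where "a = (u i)\<^sup>2"
    have a: "a \<ge> 0" by (simp add: a_def)
    have e1: "u i ^ (2 * r - 2) = a ^ (r - 1)"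
      using power_mult[of "u i" 2 k] by (simp add: a_def k)
    have e2: "u i ^ (2 * r) = a * a ^ (r - 1)"
      using power_mult[of "u i" 2 r] by (simp add: a_def k)
    show ?thesis
    proof (cases "a \<ge> G / 2")
      case True
      then have "1 * a ^ (r - 1) \<le> (2 * a / G) * a ^ (r - 1)"
        using G a by (intro mult_right_mono) (auto simp: field_simps)
      then show ?thesis unfolding e1 e2 using G
        by (simp add: add_increasing2 mult.assoc)
    next
      case False
      then have "a ^ (r - 1) \<le> (G / 2) ^ (r - 1)" using a by (intro power_mono) auto
      moreover have "0 \<le> 2 * (a * a ^ (r - 1)) / G" using a G by simp
      ultimately show ?thesis unfolding e1 e2 by linarith
    qed
  qed
  have "(\<Sum>i\<in>UNIV. u i ^ (2 * r - 2))
      \<le> (\<Sum>i\<in>UNIV. 2 * u i ^ (2 * r) / G + (G / 2) ^ (r - 1))"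
    by (rule sum_mono) (rule termwise)
  also have "\<dots> = 2 * (\<Sum>i\<in>UNIV. u i ^ (2 * r)) / G + real CARD('n) * (G / 2) ^ (r - 1)"
    by (simp add: sum.distrib sum_divide_distrib sum_distrib_left)
  also have "\<dots> \<le> 2 * G ^ r / G + 2 ^ (r - 1) * (G / 2) ^ (r - 1)"
    using G le card by (intro add_mono mult_right_mono divide_right_mono) auto
  also have "\<dots> = 3 * G ^ (r - 1)"
    using G by (simp add: power_divide k)
  finally show ?thesis .
qed

text \<open>The shift is \<delta> to the power \<open>r\<close> so that the potential equals
  \<delta> at the origin; a positive base keeps the real power \<open>1 / r\<close> smooth.\<close>

definition pot_base :: "nat \<Rightarrow> real \<Rightarrow> real^'n \<Rightarrow> real" where
  "pot_base r \<delta> x = \<delta> ^ r + (\<Sum>i\<in>UNIV. (x $ i) ^ (2 * r))"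

definition pot :: "nat \<Rightarrow> real \<Rightarrow> real^'n \<Rightarrow> real" where
  "pot r \<delta> x = pot_base r \<delta> x powr (1 / real r)"

text \<open>The gradient of \<open>pot\<close> for \<delta> > 0 and \<open>r \<ge> 1\<close>, in
  closed form. It is identified only through derivatives along lines, in
  \<open>pot_add_le\<close>.\<close>

definition pot_grad :: "nat \<Rightarrow> real \<Rightarrow> real^'n \<Rightarrow> real^'n" where
  "pot_grad r \<delta> x = (\<chi> i. 2 * (x $ i) ^ (2 * r - 1) * pot_base r \<delta> x powr (1 / real r - 1))"

lemma pot_base_pos: "\<delta> > 0 \<Longrightarrow> pot_base r \<delta> x > 0"
  unfolding pot_base_def by (intro add_pos_nonneg sum_nonneg) auto

lemma pot_pos: "\<delta> > 0 \<Longrightarrow> pot r \<delta> x > 0"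
  using pot_base_pos[of \<delta> r x] by (simp add: pot_def)

lemma pot_power: "\<delta> > 0 \<Longrightarrow> r \<ge> 1 \<Longrightarrow> pot r \<delta> x ^ r = pot_base r \<delta> x"
  using pot_base_pos[of \<delta> r x] by (simp add: pot_def powr_powr flip: powr_realpow)

lemma pot_zero: "\<delta> > 0 \<Longrightarrow> r \<ge> 1 \<Longrightarrow> pot r \<delta> 0 = \<delta>"
  by (simp add: pot_def pot_base_def powr_powr power_0_left flip: powr_realpow[of \<delta>])

lemma nth_sq_le_pot:
  assumes "\<delta> > 0" "r \<ge> 1"
  shows "(x $ i)\<^sup>2 \<le> pot r \<delta> x"
proof -
  have "(x $ i) ^ (2 * r) \<le> (\<Sum>i\<in>UNIV. (x $ i) ^ (2 * r))"
    by (rule member_le_sum) auto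
  then have "((x $ i)\<^sup>2) ^ r \<le> pot r \<delta> x ^ r"
    using assms by (simp add: pot_power pot_base_def add_increasing flip: power_mult)
  then show ?thesis
    using power_le_imp_le_base[of _ "r - 1"] assms pot_pos[of \<delta> r x]
    by (metis Suc_pred' less_eq_Suc_le One_nat_def less_imp_le)
qed

lemma infnorm_sq_le_pot:
  assumes "\<delta> > 0" "r \<ge> 1"
  shows "(infnorm x)\<^sup>2 \<le> pot r \<delta> x"
  using infnorm_attained[of x] nth_sq_le_pot[OF assms, of x] by auto

lemma pot_base_powr:
  assumes "\<delta> > 0" "r \<ge> 1"
  shows "pot_base r \<delta> x powr (1 / real r - 1) = 1 / pot r \<delta> x ^ (r - 1)"
proof -
  have "pot_base r \<delta> x powr (1 / real r - 1) = pot r \<delta> x / pot r \<delta> x ^ r"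
    using assms pot_base_pos[of \<delta> r x] by (simp add: pot_power powr_diff) (simp add: pot_def)
  also have "\<dots> = 1 / pot r \<delta> x ^ (r - 1)"
    using assms pot_pos[of \<delta> r x] by (simp add: power_eq_if)
  finally show ?thesis .
qed

text \<open>Each coordinate of the gradient is a power of a coordinate bounded by the root of
  \<open>pot\<close>, and the exponents cancel down to one factor \<open>pot\<close>. This makes the
  linear term of the expansion integrable.\<close>

lemma pot_grad_bound:
  assumes \<delta>: "\<delta> > 0" and r: "r \<ge> 1"
  shows "(infnorm (pot_grad r \<delta> x))\<^sup>2 \<le> 4 * pot r \<delta> x"
proof -
  obtain i where i: "infnorm (pot_grad r \<delta> x) = \<bar>pot_grad r \<delta> x $ i\<bar>"
    using infnorm_attained by blast
  define p where "p = pot r \<delta> x"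
  have p: "p > 0" unfolding p_def by (rule pot_pos[OF \<delta>])
  have "(infnorm (pot_grad r \<delta> x))\<^sup>2 = 4 * ((x $ i)\<^sup>2) ^ (2 * r - 1) / (p ^ (r - 1))\<^sup>2"
    unfolding i by (simp add: pot_grad_def pot_base_powr[OF \<delta> r] p_def power_mult_distrib power_divide)
      (metis mult.commute power_mult)
  also have "\<dots> \<le> 4 * p ^ (2 * r - 1) / (p ^ (r - 1))\<^sup>2"
    using nth_sq_le_pot[OF \<delta> r, of x i]
    by (intro divide_right_mono mult_left_mono power_mono) (auto simp: p_def)
  also have "p ^ (2 * r - 1) = p * (p ^ (r - 1))\<^sup>2"
  proof -
    have "2 * r - 1 = Suc ((r - 1) * 2)" using r by simp
    then show ?thesis by (simp only: power_Suc power_mult)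
  qed
  finally show ?thesis using p by (simp add: p_def)
qed

lemma continuous_on_pot_base: "continuous_on UNIV (pot_base r \<delta>)"
  unfolding pot_base_def by (intro continuous_intros)

lemma continuous_on_pot: "\<delta> > 0 \<Longrightarrow> continuous_on UNIV (pot r \<delta>)"
  unfolding pot_def
  by (intro continuous_on_powr continuous_on_pot_base continuous_on_const ballI
      less_imp_neq[symmetric] pot_base_pos)

lemma continuous_on_pot_grad: "\<delta> > 0 \<Longrightarrow> continuous_on UNIV (pot_grad r \<delta>)"
  unfolding pot_grad_def
  by (intro continuous_on_vec_lambda continuous_on_mult continuous_on_power continuous_on_component
      continuous_on_powr continuous_on_pot_base continuous_on_const continuous_on_id ballI
      less_imp_neq[symmetric] pot_base_pos)

text \<open>Second-order Taylor expansion along the segment from \<open>x\<close> to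
  \<open>x + y\<close>. The inner second derivative carries \<open>2 r (2 r - 1)\<close> and,
  through \<open>power_sum_bound\<close>, a factor \<open>3\<close>; the outer exponent contributes
  \<open>1 / r\<close> and the Taylor remainder \<open>1 / 2\<close>.\<close>

lemma pot_add_le:
  fixes x y :: "real^'n"
  assumes \<delta>: "\<delta> > 0" and r: "r \<ge> 1" and card: "real CARD('n) \<le> 2 ^ (r - 1)"
  shows "pot r \<delta> (x + y) \<le> pot r \<delta> x + pot_grad r \<delta> x \<bullet> y + 3 * (2 * real r - 1) * (infnorm y)\<^sup>2"
proof -
  define u where "u s i = x $ i + s * y $ i" for s i
  define g where "g s = \<delta> ^ r + (\<Sum>i\<in>UNIV. u s i ^ (2 * r))" for s
  define g1 where "g1 s = (\<Sum>i\<in>UNIV. 2 * real r * u s i ^ (2 * r - 1) * y $ i)" for s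
  define g2 where "g2 s = (\<Sum>i\<in>UNIV. 2 * real r * (2 * real r - 1) * u s i ^ (2 * r - 2) * (y $ i)\<^sup>2)" for s
  define q where "q = 1 / real r"
  define \<phi> where "\<phi> s = g s powr q" for s
  define \<phi>1 where "\<phi>1 s = q * g s powr (q - 1) * g1 s" for s
  define \<phi>2 where "\<phi>2 s = q * (q - 1) * g s powr (q - 2) * (g1 s)\<^sup>2 + q * g s powr (q - 1) * g2 s" for s
  have g: "g s = pot_base r \<delta> (x + s *\<^sub>R y)" for s
    by (simp add: g_def pot_base_def u_def)
  have gpos: "g s > 0" for s unfolding g by (rule pot_base_pos[OF \<delta>])
  have \<phi>: "\<phi> s = pot r \<delta> (x + s *\<^sub>R y)" for s by (simp add: \<phi>_def pot_def g q_def)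
  have dg: "(g has_real_derivative g1 s) (at s)" for s
    unfolding g_def g1_def u_def
    by (auto intro!: derivative_eq_intros sum.cong simp: of_nat_diff)
  have dg1: "(g1 has_real_derivative g2 s) (at s)" for s
    unfolding g1_def g2_def u_def using r
    by (auto intro!: derivative_eq_intros sum.cong simp: of_nat_diff power2_eq_square algebra_simps numeral_2_eq_2)
  have d\<phi>: "(\<phi> has_real_derivative \<phi>1 s) (at s)" for s
    unfolding \<phi>_def \<phi>1_def using gpos[of s]
    by (auto intro!: derivative_eq_intros dg)
  have d\<phi>1: "(\<phi>1 has_real_derivative \<phi>2 s) (at s)" for s
    unfolding \<phi>1_def \<phi>2_def using gpos[of s]
    by (auto intro!: derivative_eq_intros dg dg1 simp: power2_eq_square algebra_simps)
  obtain s where s: "\<phi> 1 = \<phi> 0 + \<phi>1 0 + \<phi>2 s / 2"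
  proof -
    define diff where "diff n = (if n = 0 then \<phi> else if n = 1 then \<phi>1 else \<phi>2)" for n :: nat
    have "\<exists>s. 0 < s \<and> s < 1 \<and>
        \<phi> 1 = (\<Sum>m<2. diff m 0 / fact m * 1 ^ m) + diff 2 s / fact 2 * 1 ^ 2"
      by (rule Maclaurin) (auto simp: diff_def less_Suc_eq numeral_2_eq_2 d\<phi> d\<phi>1)
    then show ?thesis using that by (auto simp: diff_def numeral_2_eq_2)
  qed
  have q: "q > 0" "q \<le> 1" using r by (auto simp: q_def)
  \<comment> \<open>The exponent \<open>q = 1 / r\<close> is at most \<open>1\<close>, so the term
    with the square of \<open>g1 s\<close> is nonpositive.\<close>
  have "\<phi>2 s \<le> q * g s powr (q - 1) * g2 s"
  proof -
    have "q * (q - 1) * g s powr (q - 2) * (g1 s)\<^sup>2 \<le> 0"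
      using q by (intro mult_nonpos_nonneg mult_nonneg_nonpos) auto
    then show ?thesis by (simp add: \<phi>2_def)
  qed
  also have "g2 s \<le> (\<Sum>i\<in>UNIV. 2 * real r * (2 * real r - 1) * u s i ^ (2 * r - 2) * (infnorm y)\<^sup>2)"
    unfolding g2_def using r
    by (intro sum_mono mult_left_mono)
      (auto intro!: abs_le_square_iff[THEN iffD1] mult_nonneg_nonneg simp: abs_nth_le_infnorm
        infnorm_pos_le zero_le_even_power)
  also have "\<dots> = 2 * real r * (2 * real r - 1) * (infnorm y)\<^sup>2 * (\<Sum>i\<in>UNIV. u s i ^ (2 * r - 2))"
    by (simp add: sum_distrib_left mult_ac)
  \<comment> \<open>Here \<open>G\<close> is the potential at the intermediate point, so its power
    \<open>r - 1\<close> is cancelled by \<open>g s powr (q - 1)\<close>.\<close>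
  also have "(\<Sum>i\<in>UNIV. u s i ^ (2 * r - 2)) \<le> 3 * \<phi> s ^ (r - 1)"
  proof (rule power_sum_bound[OF r card])
    show "\<phi> s > 0" using gpos[of s] by (simp add: \<phi>_def)
    show "(\<Sum>i\<in>UNIV. u s i ^ (2 * r)) \<le> \<phi> s ^ r"
      unfolding \<phi> pot_power[OF \<delta> r] g[symmetric] using \<delta> by (simp add: g_def)
  qed
  finally have "\<phi>2 s \<le> q * g s powr (q - 1) *
      (2 * real r * (2 * real r - 1) * (infnorm y)\<^sup>2 * (3 * \<phi> s ^ (r - 1)))"
    using q r by (simp add: mult_left_mono)
  also have "g s powr (q - 1) = 1 / \<phi> s ^ (r - 1)"
    unfolding g \<phi> q_def by (rule pot_base_powr[OF \<delta> r])
  finally have "\<phi>2 s / 2 \<le> 3 * (2 * real r - 1) * (infnorm y)\<^sup>2"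
    using r gpos[of s] by (simp add: q_def \<phi>_def mult.assoc) (simp add: algebra_simps)
  moreover have "\<phi>1 0 = pot_grad r \<delta> x \<bullet> y"
    using r by (simp add: \<phi>1_def g g1_def u_def q_def pot_grad_def inner_vec_def sum_distrib_left
      mult_ac)
  ultimately show ?thesis using s by (simp add: \<phi>)
qed

text \<open>The least admissible \<open>r\<close> is about \<open>log 2 d\<close>, so the curvature
  constant is linear in \<open>ln d\<close>. It is dominated by a quadratic because
  \<open>d \<ge> 2\<close> keeps \<open>ln d\<close> away from \<open>0\<close> and the factor
  \<open>e^4\<close> is generous.\<close>

lemma log_dimension_bound:
  assumes "2 \<le> (d :: nat)"
  obtains r where "r \<ge> 1" "real d \<le> 2 ^ (r - 1)"
    "3 * (2 * real r - 1) \<le> ((exp 1)\<^sup>2 * ln (real d))\<^sup>2"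
proof -
  define r where "r = nat \<lceil>log 2 (real d)\<rceil> + 1"
  have l1: "log 2 (real d) \<ge> 1" using assms by (simp add: le_log_iff)
  have "real d = 2 powr log 2 (real d)" using assms by simp
  also have "\<dots> \<le> 2 powr real (r - 1)" by (intro powr_mono) (auto simp: r_def real_nat_ceiling_ge)
  finally have a: "real d \<le> 2 ^ (r - 1)" by (simp add: powr_realpow)
  define y where "y = ln (real d)"
  have ln2: "ln (2::real) \<ge> 2/3" by (rule ln2_ge_two_thirds)
  have y: "y \<ge> 2/3" using ln2 assms unfolding y_def
    by (meson ln_mono numeral_le_real_of_nat_iff order_trans zero_less_numeral)
  have "log 2 (real d) = y / ln 2" by (simp add: log_def y_def)
  also have "\<dots> \<le> y / (2/3)" using y ln2 by (intro divide_left_mono mult_pos_pos) auto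
  finally have l2: "log 2 (real d) \<le> 3/2 * y" by simp
  have "real r \<le> log 2 (real d) + 2" using l1 unfolding r_def by linarith
  with l2 have "real r \<le> 3/2 * y + 2" by linarith
  then have "3 * (2 * real r - 1) \<le> 9 * y + 9" by (simp add: field_simps)
  \<comment> \<open>From \<open>y \<ge> 2/3\<close>, both \<open>2/3 * y\<close> and
    \<open>(2/3)^2\<close> are at most \<open>y * y\<close>. The weights \<open>18\<close> and
    \<open>20\<close> add up to \<open>38\<close>, just below \<open>(5/2)^4\<close>, which is at
    most \<open>e^4\<close>.\<close>
  also have "\<dots> \<le> 18 * (2/3 * y) + 20 * (2/3 * (2/3))" using y by simp
  also have "\<dots> \<le> 38 * (y * y)"
  proof -
    have "2/3 * y \<le> y * y" "2/3 * (2/3) \<le> y * y" 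
      using y by (intro mult_mono; simp)+
    then show ?thesis by linarith
  qed
  also have "\<dots> \<le> ((exp 1)\<^sup>2 * y)\<^sup>2"
  proof -
    have "(5/2 :: real) \<le> exp 1" using exp_lower_Taylor_quadratic[of 1] by simp
    then have "(5/2) ^ 4 \<le> (exp 1 :: real) ^ 4" by (intro power_mono) auto
    then have "38 \<le> (exp 1 :: real) ^ 4" by (simp add: power_divide)
    then have "38 * (y * y) \<le> (exp 1) ^ 4 * (y * y)" by (intro mult_right_mono) auto
    then show ?thesis by (simp add: power2_eq_square power4_eq_xxxx algebra_simps)
  qed
  finally show ?thesis using that[of r] a by (simp add: r_def y_def)
qed

section \<open>Stationarity measure\<close>

lemma l1norm_nonneg: "0 \<le> l1norm x"
  by (simp add: l1norm_def sum_nonneg)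

lemma l1norm_zero [simp]: "l1norm 0 = 0"
  by (simp add: l1norm_def)

lemma l1norm_triangle: "l1norm (x + y) \<le> l1norm x + l1norm y"
  by (simp add: l1norm_def flip: sum.distrib) (intro sum_mono abs_triangle_ineq)

lemma l1norm_scaleR: "l1norm (c *\<^sub>R x) = \<bar>c\<bar> * l1norm x"
  by (simp add: l1norm_def abs_mult sum_distrib_left)

lemma l1norm_minus_commute: "l1norm (x - y) = l1norm (y - x)"
  by (simp add: l1norm_def abs_minus_commute)

lemma continuous_on_l1norm [continuous_intros]:
  "continuous_on S g \<Longrightarrow> continuous_on S (\<lambda>x. l1norm (g x))"
  unfolding l1norm_def by (intro continuous_intros)

lemma norm_le_l1norm: "norm x \<le> l1norm x"
  by (simp add: l1norm_def norm_le_l1_cart)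

lemma infnorm_le_l1norm: "infnorm x \<le> l1norm x"
  using infnorm_le_norm norm_le_l1norm by (rule order_trans)

lemma inner_le_infnorm_l1norm: "\<bar>x \<bullet> y\<bar> \<le> infnorm x * l1norm y"
proof -
  have "\<bar>x \<bullet> y\<bar> \<le> (\<Sum>i\<in>UNIV. \<bar>x $ i\<bar> * \<bar>y $ i\<bar>)"
    unfolding inner_vec_def by (rule order_trans[OF sum_abs]) (simp add: abs_mult)
  also have "\<dots> \<le> (\<Sum>i\<in>UNIV. infnorm x * \<bar>y $ i\<bar>)"
    by (intro sum_mono mult_right_mono abs_nth_le_infnorm) auto
  finally show ?thesis by (simp add: l1norm_def sum_distrib_left)
qed

lemma l1norm_axis: "l1norm (axis i c) = \<bar>c\<bar>"
proof -
  have "l1norm (axis i c) = (\<Sum>j\<in>UNIV. if j = i then \<bar>c\<bar> else 0)"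
    unfolding l1norm_def axis_def by (intro sum.cong) auto
  then show ?thesis by simp
qed

text \<open>A vertex of the l1-ball, on the axis of a largest coordinate and with its sign, already
  realises the max-norm.\<close>

lemma infnorm_le_of_l1ball:
  assumes "\<And>z. l1norm z \<le> \<psi> \<Longrightarrow> v \<bullet> z \<le> c" and "\<psi> \<ge> 0"
  shows "\<psi> * infnorm v \<le> c"
proof -
  obtain i where i: "infnorm v = \<bar>v $ i\<bar>" using infnorm_attained by blast
  have "v \<bullet> axis i (\<psi> * sgn (v $ i)) \<le> c"
    using \<open>\<psi> \<ge> 0\<close> by (intro assms(1)) (simp add: l1norm_axis abs_mult abs_sgn_eq)
  then show ?thesis by (simp add: i inner_axis mult_ac abs_sgn)
qed

lemma convex_l1ball: "convex {y. l1norm (y - x :: real^'n) \<le> \<psi>}"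
proof (rule convexI)
  fix a b :: "real^'n" and u v :: real
  assume ab: "a \<in> {y. l1norm (y - x) \<le> \<psi>}" "b \<in> {y. l1norm (y - x) \<le> \<psi>}"
    and uv: "0 \<le> u" "0 \<le> v" "u + v = 1"
  have "u *\<^sub>R a + v *\<^sub>R b - x = u *\<^sub>R a + v *\<^sub>R b - (u + v) *\<^sub>R x" by (simp add: uv)
  also have "\<dots> = u *\<^sub>R (a - x) + v *\<^sub>R (b - x)" by (simp add: algebra_simps)
  also have "l1norm \<dots> \<le> u * l1norm (a - x) + v * l1norm (b - x)"
    using l1norm_triangle[of "u *\<^sub>R (a - x)" "v *\<^sub>R (b - x)"] uv by (simp add: l1norm_scaleR)
  also have "\<dots> \<le> \<psi>" using ab uv by (simp add: convex_bound_le)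
  finally show "u *\<^sub>R a + v *\<^sub>R b \<in> {y. l1norm (y - x) \<le> \<psi>}" by simp
qed

lemma closed_l1ball: "closed {y. l1norm (y - x) \<le> \<psi>}"
  by (intro closed_Collect_le continuous_intros)

text \<open>Uniqueness of derivatives justifies the definite description in \<open>grad\<close>; the
  witness is read off the values of the derivative on the basis.\<close>

lemma gderiv_grad:
  fixes h :: "real^'n \<Rightarrow> real"
  assumes "h differentiable (at x)"
  shows "GDERIV h x :> grad h x"
proof -
  obtain h' where h': "(h has_derivative h') (at x)"
    using assms by (auto simp: differentiable_def)
  define g where "g = (\<Sum>b\<in>Basis. h' b *\<^sub>R b)"
  have "h' = (\<lambda>v. v \<bullet> g)"
  proof
    fix v
    interpret bounded_linear h' using h' by (rule has_derivative_bounded_linear)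
    have "h' v = h' (\<Sum>b\<in>Basis. (v \<bullet> b) *\<^sub>R b)" by (simp add: euclidean_representation)
    also have "\<dots> = (\<Sum>b\<in>Basis. (v \<bullet> b) * h' b)" by (simp add: sum scaleR)
    finally show "h' v = v \<bullet> g" by (simp add: g_def inner_sum_right mult.commute)
  qed
  then have D: "GDERIV h x :> g" using h' by (simp add: gderiv_def)
  show ?thesis unfolding grad_def
  proof (rule theI[of _ g])
    show "GDERIV h x :> g" by (rule D)
    fix d assume "GDERIV h x :> d"
    then have "(\<lambda>v. v \<bullet> d) = (\<lambda>v. v \<bullet> g)" using D unfolding gderiv_def
      by (rule has_derivative_unique)
    then show "d = g" by (metis inner_commute vector_eq_rdot)
  qed
qed

lemma gderiv_along_line:
  assumes "GDERIV h (x + s *\<^sub>R v) :> g"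
  shows "((\<lambda>s. h (x + s *\<^sub>R v)) has_real_derivative v \<bullet> g) (at s)"
proof -
  have "((\<lambda>s. h (x + s *\<^sub>R v)) has_derivative (\<lambda>t. (t *\<^sub>R v) \<bullet> g)) (at s)"
  proof (rule has_derivative_compose[of "\<lambda>s. x + s *\<^sub>R v" "\<lambda>t. t *\<^sub>R v" s UNIV h])
    show "((\<lambda>s. x + s *\<^sub>R v) has_derivative (\<lambda>t. t *\<^sub>R v)) (at s)"
      by (auto intro!: derivative_eq_intros)
    show "(h has_derivative (\<lambda>v. v \<bullet> g)) (at (x + s *\<^sub>R v))"
      using assms by (simp add: gderiv_def)
  qed
  then show ?thesis by (simp add: has_field_derivative_def mult_commute_abs)
qed

text \<open>No integral along the segment: once the candidate bound is subtracted, the function of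
  the segment parameter has nonpositive derivative, by pairing the max-norm with the
  l1-norm.\<close>

lemma descent_lemma:
  fixes f :: "real^'n \<Rightarrow> real"
  assumes X: "convex X" "x \<in> X" "y \<in> X"
    and f: "\<And>u. u \<in> X \<Longrightarrow> f differentiable (at u)"
    and lip: "\<And>u v. u \<in> X \<Longrightarrow> v \<in> X \<Longrightarrow> infnorm (grad f u - grad f v) \<le> L * l1norm (u - v)"
  shows "f y \<le> f x + grad f x \<bullet> (y - x) + L / 2 * (l1norm (y - x))\<^sup>2"
proof -
  define v where "v = y - x"
  define N where "N = l1norm v"
  define \<phi> where "\<phi> s = f (x + s *\<^sub>R v) - s * (grad f x \<bullet> v) - L / 2 * s\<^sup>2 * N\<^sup>2" for s
  have inX: "x + s *\<^sub>R v \<in> X" if "0 \<le> s" "s \<le> 1" for s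
    using convexD_alt[OF X that] by (simp add: v_def algebra_simps)
  have "\<phi> 1 \<le> \<phi> 0"
  proof (rule DERIV_nonpos_imp_nonincreasing[of 0 1 \<phi>])
    fix s :: real assume s: "0 \<le> s" "s \<le> 1"
    have D: "(\<phi> has_real_derivative
        v \<bullet> grad f (x + s *\<^sub>R v) - grad f x \<bullet> v - L * s * N\<^sup>2) (at s)"
      unfolding \<phi>_def
      by (auto intro!: derivative_eq_intros gderiv_along_line gderiv_grad f inX s)
    have "v \<bullet> grad f (x + s *\<^sub>R v) - grad f x \<bullet> v = (grad f (x + s *\<^sub>R v) - grad f x) \<bullet> v"
      by (simp add: inner_commute inner_diff)
    also have "\<dots> \<le> infnorm (grad f (x + s *\<^sub>R v) - grad f x) * N"
      using inner_le_infnorm_l1norm[of "grad f (x + s *\<^sub>R v) - grad f x" v] by (simp add: N_def)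
    also have "\<dots> \<le> (L * l1norm (x + s *\<^sub>R v - x)) * N"
      by (intro mult_right_mono lip inX s X) (simp add: N_def l1norm_nonneg)
    also have "\<dots> = L * s * N\<^sup>2" using s by (simp add: l1norm_scaleR N_def power2_eq_square)
    finally show "\<exists>d. (\<phi> has_real_derivative d) (at s) \<and> d \<le> 0" using D by auto
  qed simp
  then show ?thesis by (simp add: \<phi>_def N_def v_def)
qed

section \<open>The normal cone and the Frechet subdifferential\<close>

definition normals :: "(real^'n) set \<Rightarrow> real^'n \<Rightarrow> (real^'n) set" where
  "normals X x = {n. \<forall>y\<in>X. n \<bullet> (y - x) \<le> 0}"

text \<open>For one inclusion, \<open>x\<close> is approached along the segment to a point of
  \<open>X\<close>, where the quotient converges to a directional expression. For the other, the
  quotient is infinite off \<open>X\<close>, and on \<open>X\<close> it is at least the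
  differentiation remainder of \<open>f\<close>, which tends to \<open>0\<close>.\<close>

lemma frechet_subdiff_add_delta:
  fixes f :: "real^'n \<Rightarrow> real"
  assumes X: "convex X" "x \<in> X" and f: "f differentiable (at x)"
  shows "frechet_subdiff (\<lambda>y. ereal (f y) + delta X y) x = (+) (grad f x) ` normals X x"
proof (intro set_eqI iffI)
  have G: "GDERIV f x :> grad f x" using f by (rule gderiv_grad)
  fix v
  let ?q = "\<lambda>y. (ereal (f y) + delta X y - (ereal (f x) + delta X x) - ereal (v \<bullet> (y - x))) / ereal (norm (y - x))"
  have qX: "?q y = ereal ((f y - f x - v \<bullet> (y - x)) / norm (y - x))"
    if "y \<in> X" "y \<noteq> x" for y
  proof -
    have "delta X y = ereal 0" "delta X x = ereal 0" using that X by (auto simp: delta_def)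
    then show ?thesis using that by (simp only: ereal_minus plus_ereal.simps ereal_divide) simp
  qed
  {
    assume "v \<in> frechet_subdiff (\<lambda>y. ereal (f y) + delta X y) x"
    then have lim: "0 \<le> Liminf (at x) ?q" by (auto simp: frechet_subdiff_def)
    have "v - grad f x \<in> normals X x"
      unfolding normals_def
    proof (intro CollectI ballI)
      fix y assume y: "y \<in> X"
      show "(v - grad f x) \<bullet> (y - x) \<le> 0"
      proof (cases "y = x")
        case False
        define d where "d = y - x"
        have d: "norm d > 0" using False by (simp add: d_def)
        have "((\<lambda>s. f (x + s *\<^sub>R d)) has_real_derivative d \<bullet> grad f x) (at 0)"
          by (rule gderiv_along_line) (simp add: G)
        then have "((\<lambda>s. (f (x + s *\<^sub>R d) - f x) / s) \<longlongrightarrow> d \<bullet> grad f x) (at 0)"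
          by (simp add: has_field_derivative_iff)
        then have "((\<lambda>s. (f (x + s *\<^sub>R d) - f x) / s) \<longlongrightarrow> d \<bullet> grad f x) (at_right 0)"
          by (rule tendsto_within_subset) simp
        then have T: "((\<lambda>s. ((f (x + s *\<^sub>R d) - f x) / s - v \<bullet> d) / norm d)
            \<longlongrightarrow> (d \<bullet> grad f x - v \<bullet> d) / norm d) (at_right 0)"
          by (intro tendsto_divide tendsto_diff tendsto_const) (use d in auto)
        have fl: "filterlim (\<lambda>s. x + s *\<^sub>R d) (at x) (at_right (0::real))"
          unfolding filterlim_at
        proof
          have "((\<lambda>s. x + s *\<^sub>R d) \<longlongrightarrow> x + 0 *\<^sub>R d) (at_right (0::real))"
            by (intro tendsto_intros)
          then show "((\<lambda>s. x + s *\<^sub>R d) \<longlongrightarrow> x) (at_right (0::real))" by simp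
          show "\<forall>\<^sub>F s in at_right (0::real). x + s *\<^sub>R d \<in> UNIV \<and> x + s *\<^sub>R d \<noteq> x"
            by (rule eventually_mono[OF eventually_at_right_less[of 0]]) (use d in auto)
        qed
        have ev: "\<forall>\<^sub>F s in at_right (0::real). 0 < s \<and> s < 1"
          by (rule eventually_at_rightI[of 0 1]) auto
        \<comment> \<open>A bound valid near \<open>x\<close> persists along the segment, because
          \<open>x + s *\<^sub>R d\<close> tends to \<open>x\<close> without meeting it.\<close>
        have "0 \<le> Liminf (at_right 0) (\<lambda>s. ?q (x + s *\<^sub>R d))"
          unfolding le_Liminf_iff
        proof (intro allI impI)
          fix c :: ereal assume "c < 0"
          then have "\<forall>\<^sub>F y in at x. c < ?q y" using lim unfolding le_Liminf_iff by blast
          then show "\<forall>\<^sub>F s in at_right 0. c < ?q (x + s *\<^sub>R d)"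
            by (rule eventually_compose_filterlim[OF _ fl])
        qed
        also have "\<dots> = Liminf (at_right 0) (\<lambda>s. ereal (((f (x + s *\<^sub>R d) - f x) / s - v \<bullet> d) / norm d))"
        proof (rule Liminf_eq, rule eventually_mono[OF ev])
          fix s :: real assume s: "0 < s \<and> s < 1"
          have "x + s *\<^sub>R d \<in> X"
            using convexD_alt[OF X y, of s] s by (simp add: d_def algebra_simps)
          then have "?q (x + s *\<^sub>R d) = ereal ((f (x + s *\<^sub>R d) - f x - v \<bullet> (s *\<^sub>R d)) / norm (s *\<^sub>R d))"
            using s d by (subst qX) auto
          also have "\<dots> = ereal (((f (x + s *\<^sub>R d) - f x) / s - v \<bullet> d) / norm d)"
            using s d by (simp add: field_simps)
          finally show "?q (x + s *\<^sub>R d) = ereal (((f (x + s *\<^sub>R d) - f x) / s - v \<bullet> d) / norm d)" .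
        qed
        also have "\<dots> = ereal ((d \<bullet> grad f x - v \<bullet> d) / norm d)"
          by (intro lim_imp_Liminf tendsto_ereal T) simp
        finally have "0 \<le> (d \<bullet> grad f x - v \<bullet> d) / norm d" by simp
        then show ?thesis using d
          by (simp add: zero_le_divide_iff d_def[symmetric] inner_diff_left inner_diff_right inner_commute)
      qed simp
    qed
    then show "v \<in> (+) (grad f x) ` normals X x" by (force intro: image_eqI[of _ _ "v - grad f x"])
  }
  {
    assume "v \<in> (+) (grad f x) ` normals X x"
    then obtain n where n: "n \<in> normals X x" and v: "v = grad f x + n" by auto
    let ?r = "\<lambda>y. (f y - f x - grad f x \<bullet> (y - x)) / norm (y - x)"
    have "((\<lambda>y. (f y - f x - (y - x) \<bullet> grad f x) /\<^sub>R norm (y - x)) \<longlongrightarrow> 0) (at x)"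
      using G unfolding gderiv_def has_derivative_at_within by simp
    then have T: "((\<lambda>y. ereal (?r y)) \<longlongrightarrow> ereal 0) (at x)"
      by (intro tendsto_ereal) (simp add: inner_commute divide_inverse_commute)
    have le: "ereal (?r y) \<le> ?q y" if "y \<noteq> x" for y
    proof (cases "y \<in> X")
      case True
      then have "n \<bullet> (y - x) \<le> 0" using n by (simp add: normals_def)
      then show ?thesis unfolding qX[OF True that] by (simp add: v inner_add_left divide_right_mono)
    next
      case False
      then show ?thesis using X that by (simp add: delta_def divide_ereal_def)
    qed
    have "ereal 0 = Liminf (at x) (\<lambda>y. ereal (?r y))"
      using lim_imp_Liminf[OF _ T] by simp
    also have "\<dots> \<le> Liminf (at x) ?q"
      by (intro Liminf_mono) (auto simp: eventually_at_filter le)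
    finally show "v \<in> frechet_subdiff (\<lambda>y. ereal (f y) + delta X y) x"
      using X by (simp add: frechet_subdiff_def delta_def zero_ereal_def)
  }
qed

section \<open>The distance to the subdifferential and its measurability\<close>

lemma zero_in_normals: "0 \<in> normals X x"
  by (simp add: normals_def)

lemma dist0_infnorm_le: "v \<in> S \<Longrightarrow> dist0_infnorm S \<le> infnorm v"
  unfolding dist0_infnorm_def
  by (intro cINF_lower bdd_belowI2[where m = 0]) (auto simp: infnorm_pos_le)

lemma dist0_infnorm_nonneg: "S \<noteq> {} \<Longrightarrow> 0 \<le> dist0_infnorm S"
  unfolding dist0_infnorm_def by (intro cINF_greatest) (auto simp: infnorm_pos_le)

text \<open>The normal \<open>n\<close> ranges over a possibly unbounded cone, but
  \<open>w = snd p + n\<close> ranges over a compact max-norm ball. In the variables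
  \<open>w\<close> and \<open>p\<close> the condition is closed, and projecting along a compact
  factor keeps it closed.\<close>

lemma closed_normals_sublevel:
  fixes X :: "(real^'n) set"
  assumes "closed X"
  shows "closed {p. fst p \<in> X \<and> (\<exists>n\<in>normals X (fst p). infnorm (snd p + n) \<le> c)}"
proof -
  have "compact {w :: real^'n. infnorm w \<le> c}"
  proof (intro compact_eq_bounded_closed[THEN iffD2] conjI)
    have "norm w \<le> sqrt (real DIM(real^'n)) * c" if "infnorm w \<le> c" for w :: "real^'n"
      by (rule order_trans[OF norm_le_infnorm])
        (intro mult_left_mono that real_sqrt_ge_zero of_nat_0_le_iff)
    then show "bounded {w :: real^'n. infnorm w \<le> c}"
      by (intro boundedI) auto
    show "closed {w :: real^'n. infnorm w \<le> c}" by (intro closed_Collect_le continuous_intros)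
  qed
  moreover have "closed {q :: (real^'n) \<times> ((real^'n) \<times> (real^'n)). fst (snd q) \<in> X \<and>
      (\<forall>y\<in>X. (fst q - snd (snd q)) \<bullet> (y - fst (snd q)) \<le> 0)}"
  proof (intro closed_Collect_conj)
    show "closed {q :: (real^'n) \<times> ((real^'n) \<times> (real^'n)). fst (snd q) \<in> X}"
      using continuous_closed_vimage[OF assms, of "\<lambda>q. fst (snd q)"]
      by (simp add: vimage_def)
    have "{q :: (real^'n) \<times> ((real^'n) \<times> (real^'n)). \<forall>y\<in>X. (fst q - snd (snd q)) \<bullet> (y - fst (snd q)) \<le> 0}
      = (\<Inter>y\<in>X. {q. (fst q - snd (snd q)) \<bullet> (y - fst (snd q)) \<le> 0})" by auto
    also have "closed \<dots>" by (intro closed_INT ballI closed_Collect_le continuous_intros)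
    finally show "closed {q :: (real^'n) \<times> ((real^'n) \<times> (real^'n)).
      \<forall>y\<in>X. (fst q - snd (snd q)) \<bullet> (y - fst (snd q)) \<le> 0}" .
  qed
  ultimately have "closed {p. \<exists>w. w \<in> {w :: real^'n. infnorm w \<le> c} \<and> (w, p) \<in> {q. fst (snd q) \<in> X \<and>
      (\<forall>y\<in>X. (fst q - snd (snd q)) \<bullet> (y - fst (snd q)) \<le> 0)}}"
    by (rule closed_compact_projection)
  also have "{p. \<exists>w. w \<in> {w :: real^'n. infnorm w \<le> c} \<and> (w, p) \<in> {q. fst (snd q) \<in> X \<and>
      (\<forall>y\<in>X. (fst q - snd (snd q)) \<bullet> (y - fst (snd q)) \<le> 0)}}
    = {p. fst p \<in> X \<and> (\<exists>n\<in>normals X (fst p). infnorm (snd p + n) \<le> c)}"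
  proof (intro Collect_cong iffI; clarsimp)
    fix a b w assume "infnorm w \<le> c" "\<forall>y\<in>X. (w - b) \<bullet> (y - a) \<le> 0"
    then show "\<exists>n\<in>normals X a. infnorm (b + n) \<le> c"
      by (intro bexI[of _ "w - b"]) (auto simp: normals_def)
  next
    fix a b n assume "n \<in> normals X a" "infnorm (b + n) \<le> c"
    then show "\<exists>w. infnorm w \<le> c \<and> (\<forall>y\<in>X. (w - b) \<bullet> (y - a) \<le> 0)"
      by (intro exI[of _ "b + n"]) (auto simp: normals_def)
  qed
  finally show ?thesis .
qed

text \<open>The infimum runs over a set that varies with \<omega> and need not be countable. A value
  below \<open>c\<close> is witnessed by some normal and a rational \<open>q < c\<close>, so the
  strict sublevel set is a countable union of preimages of closed sets.\<close>

lemma borel_measurable_dist0_normals: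
  fixes U V :: "'w \<Rightarrow> real^'n"
  assumes X: "closed X" and [measurable]: "U \<in> borel_measurable M" "V \<in> borel_measurable M"
    and inX: "\<And>\<omega>. \<omega> \<in> space M \<Longrightarrow> U \<omega> \<in> X"
  shows "(\<lambda>\<omega>. dist0_infnorm ((+) (V \<omega>) ` normals X (U \<omega>))) \<in> borel_measurable M"
  unfolding borel_measurable_iff_less
proof
  fix c :: real
  define C where "C q = {p. fst p \<in> X \<and> (\<exists>n\<in>normals X (fst p). infnorm (snd p + n) \<le> q)}" for q
  have less: "dist0_infnorm ((+) (V \<omega>) ` normals X (U \<omega>)) < c \<longleftrightarrow> (\<exists>q\<in>\<rat> \<inter> {..<c}. (U \<omega>, V \<omega>) \<in> C q)"
    if "\<omega> \<in> space M" for \<omega>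
  proof
    assume "dist0_infnorm ((+) (V \<omega>) ` normals X (U \<omega>)) < c"
    then obtain n where n: "n \<in> normals X (U \<omega>)" "infnorm (V \<omega> + n) < c"
      unfolding dist0_infnorm_def
      by (subst (asm) cINF_less_iff)
        (use zero_in_normals in \<open>auto intro!: bdd_belowI2[where m = 0] simp: infnorm_pos_le\<close>)
    then obtain q where "q \<in> \<rat>" "infnorm (V \<omega> + n) < q" "q < c" using Rats_dense_in_real by blast
    then show "\<exists>q\<in>\<rat> \<inter> {..<c}. (U \<omega>, V \<omega>) \<in> C q" using n inX[OF that]
      by (auto simp: C_def intro!: bexI[of _ q] bexI[of _ n])
  next
    assume "\<exists>q\<in>\<rat> \<inter> {..<c}. (U \<omega>, V \<omega>) \<in> C q"
    then obtain q n where "q < c" "n \<in> normals X (U \<omega>)" "infnorm (V \<omega> + n) \<le> q"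
      by (auto simp: C_def)
    then show "dist0_infnorm ((+) (V \<omega>) ` normals X (U \<omega>)) < c"
      by (intro le_less_trans[OF dist0_infnorm_le[of "V \<omega> + n"]]) auto
  qed
  have "{\<omega> \<in> space M. dist0_infnorm ((+) (V \<omega>) ` normals X (U \<omega>)) < c}
    = (\<Union>q\<in>\<rat> \<inter> {..<c}. (\<lambda>\<omega>. (U \<omega>, V \<omega>)) -` C q \<inter> space M)"
    using less by auto
  also have "\<dots> \<in> sets M"
  proof (intro sets.countable_UN'' countable_Int1 countable_rat)
    fix q
    have "C q \<in> sets borel" unfolding C_def
      by (intro borel_closed closed_normals_sublevel X)
    then show "(\<lambda>\<omega>. (U \<omega>, V \<omega>)) -` C q \<inter> space M \<in> sets M"
      by (rule measurable_sets[rotated]) measurable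
  qed
  finally show "{\<omega> \<in> space M. dist0_infnorm ((+) (V \<omega>) ` normals X (U \<omega>)) < c} \<in> sets M" .
qed

section \<open>The proximal step over a trust region\<close>

definition trust_region :: "(real^'n) set \<Rightarrow> real \<Rightarrow> real^'n \<Rightarrow> (real^'n) set" where
  "trust_region X \<psi> x = X \<inter> {y. l1norm (y - x) \<le> \<psi>}"

lemma
  assumes "closed X" "convex X"
  shows closed_trust_region: "closed (trust_region X \<psi> x)"
    and convex_trust_region: "convex (trust_region X \<psi> x)"
  unfolding trust_region_def using assms
  by (auto intro: closed_Int convex_Int closed_l1ball convex_l1ball)

lemma center_in_trust_region: "x \<in> X \<Longrightarrow> \<psi> \<ge> 0 \<Longrightarrow> x \<in> trust_region X \<psi> x"
  by (simp add: trust_region_def)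

lemma prox_stepD:
  fixes X :: "(real^'n) set"
  assumes "prox_step X (delta {z. l1norm z \<le> \<psi>}) \<eta> x g x'" and x: "x \<in> X" and \<psi>: "\<psi> \<ge> 0"
  shows prox_step_in: "x' \<in> trust_region X \<psi> x"
    and prox_step_le: "y \<in> trust_region X \<psi> x \<Longrightarrow> dist (x - \<eta> *\<^sub>R g) x' \<le> dist (x - \<eta> *\<^sub>R g) y"
proof -
  define q where "q y = ereal (1/2 * (norm (y - (x - \<eta> *\<^sub>R g)))\<^sup>2) + delta {z. l1norm z \<le> \<psi>} (y - x)" for y
  have q: "q y = ereal (1/2 * (norm (y - (x - \<eta> *\<^sub>R g)))\<^sup>2)" if "l1norm (y - x) \<le> \<psi>" for y
    using that by (simp add: q_def delta_def)
  have x': "x' \<in> X" and min: "\<And>y. y \<in> X \<Longrightarrow> q x' \<le> q y"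
    using assms(1) by (auto simp: prox_step_def is_arg_min_linorder q_def)
  \<comment> \<open>The centre \<open>x\<close> is feasible with a finite value, which forces the
    minimiser into the l1-ball.\<close>
  have "q x' \<le> q x" by (rule min[OF x])
  then have "q x' < \<infinity>" using q[of x] \<psi> by auto
  then have le: "l1norm (x' - x) \<le> \<psi>" by (auto simp: q_def delta_def split: if_splits)
  then show "x' \<in> trust_region X \<psi> x" using x' by (simp add: trust_region_def)
  assume y: "y \<in> trust_region X \<psi> x"
  then have "q x' \<le> q y" by (intro min) (simp add: trust_region_def)
  then have "(norm (x' - (x - \<eta> *\<^sub>R g)))\<^sup>2 \<le> (norm (y - (x - \<eta> *\<^sub>R g)))\<^sup>2"
    using y by (simp add: q le trust_region_def)
  then show "dist (x - \<eta> *\<^sub>R g) x' \<le> dist (x - \<eta> *\<^sub>R g) y"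
    by (simp add: dist_norm norm_minus_commute)
qed

text \<open>The sum rule for the normal cone of \<open>X \<inter> (x + B)\<close>: separate the strict hypograph of \<open>0\<close> over
  \<open>x + B\<close> from the epigraph of \<open>y \<mapsto> a \<bullet> (y - x')\<close> over \<open>X\<close>. The hyperplane is not vertical
  because \<open>x\<close> lies in \<open>X\<close> and in the interior of \<open>x + B\<close>.\<close>
lemma normals_trust_region:
  fixes X :: "(real^'n) set"
  assumes X: "convex X" "x \<in> X" and \<psi>: "\<psi> > 0" and x': "x' \<in> trust_region X \<psi> x"
    and a: "\<And>y. y \<in> trust_region X \<psi> x \<Longrightarrow> 0 \<le> a \<bullet> (y - x')"
  obtains n v where "n \<in> normals X x'" "\<And>z. l1norm z \<le> \<psi> \<Longrightarrow> v \<bullet> z \<le> v \<bullet> (x' - x)" "a + v + n = 0"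
proof -
  define B where "B = {y. l1norm (y - x) \<le> \<psi>}"
  define S where "S = B \<times> {..<0::real}"
  define T where "T = {p :: (real^'n) \<times> real. fst p \<in> X \<and> a \<bullet> (fst p - x') \<le> snd p}"
  have x'XB: "x' \<in> X" "x' \<in> B" using x' by (auto simp: trust_region_def B_def)
  have xB: "x \<in> B" using \<psi> by (simp add: B_def)
  have "convex S" unfolding S_def B_def by (intro convex_Times convex_l1ball) simp
  moreover have "convex T"
  proof (rule convexI)
    fix p q u v assume *: "p \<in> T" "q \<in> T" "0 \<le> u" "0 \<le> v" "u + v = (1::real)"
    have "a \<bullet> (u *\<^sub>R fst p + v *\<^sub>R fst q - x') = a \<bullet> (u *\<^sub>R fst p + v *\<^sub>R fst q - (u + v) *\<^sub>R x')"
      using * by simp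
    also have "\<dots> = u * (a \<bullet> (fst p - x')) + v * (a \<bullet> (fst q - x'))"
      by (simp add: algebra_simps inner_add_right inner_diff_right)
    also have "\<dots> \<le> u * snd p + v * snd q"
      using * by (intro add_mono mult_left_mono) (auto simp: T_def)
    finally show "u *\<^sub>R p + v *\<^sub>R q \<in> T"
      using * convexD[OF X(1)] by (simp add: T_def)
  qed
  moreover have "S \<noteq> {}" using xB by (auto simp: S_def intro!: exI[of _ "-1"])
  moreover have "T \<noteq> {}" using x'XB by (auto simp: T_def intro!: exI[of _ x'])
  moreover have "S \<inter> T = {}"
    using a by (fastforce simp: S_def T_def B_def trust_region_def)
  ultimately obtain w \<beta> where w: "w \<noteq> 0" "\<And>p. p \<in> S \<Longrightarrow> w \<bullet> p \<le> \<beta>" "\<And>p. p \<in> T \<Longrightarrow> \<beta> \<le> w \<bullet> p"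
    using separating_hyperplane_sets[of S T] by metis
  obtain b c where wbc: "w = (b, c)" by fastforce
  have TD: "\<beta> \<le> b \<bullet> y + c * \<tau>" if "y \<in> X" "a \<bullet> (y - x') \<le> \<tau>" for y \<tau>
    using w(3)[of "(y, \<tau>)"] that by (simp add: T_def wbc)
  have SD: "b \<bullet> y \<le> \<beta>" if "y \<in> B" for y
  proof (rule field_le_epsilon)
    fix e :: real assume e: "e > 0"
    \<comment> \<open>Separation speaks only of negative \<tau>. This choice keeps
      \<open>c * \<tau>\<close> above \<open>- e\<close> whatever \<open>c\<close> is, so that
      \<tau> can in effect tend to \<open>0\<close>.\<close>
    define \<tau> where "\<tau> = - e / (\<bar>c\<bar> + 1)"
    have \<tau>: "\<tau> < 0" using e by (simp add: \<tau>_def divide_neg_pos)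
    have "b \<bullet> y + c * \<tau> \<le> \<beta>" using w(2)[of "(y, \<tau>)"] that \<tau> by (simp add: S_def wbc)
    moreover have "- e \<le> c * \<tau>"
    proof -
      have "\<bar>c * \<tau>\<bar> = \<bar>c\<bar> * e / (\<bar>c\<bar> + 1)" using e by (simp add: \<tau>_def abs_mult)
      also have "\<dots> \<le> e" using e by (simp add: field_simps)
      finally show ?thesis by linarith
    qed
    ultimately show "b \<bullet> y \<le> \<beta> + e" by linarith
  qed
  have bx': "b \<bullet> x' = \<beta>" using TD[of x' 0] SD[of x'] x'XB by simp
  have cone: "b \<bullet> z \<le> b \<bullet> (x' - x)" if "l1norm z \<le> \<psi>" for z
    using SD[of "x + z"] that by (simp add: B_def bx' inner_add_right inner_diff_right)
  have "c \<ge> 0"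
  proof (rule ccontr)
    assume "\<not> c \<ge> 0"
    then have "\<beta> \<le> b \<bullet> x' + c * 1" "c < 0" using TD[of x' 1] x'XB by auto
    then show False using bx' by simp
  qed
  moreover have "c \<noteq> 0"
  proof
    assume c: "c = 0"
    have "b \<bullet> (x' - x) \<le> 0" using TD[OF X(2), of "a \<bullet> (x - x')"] c
      by (simp add: inner_diff_right bx')
    then have "\<psi> * infnorm b \<le> 0" using cone \<psi> by (intro infnorm_le_of_l1ball) force+
    then have "b = 0" using \<psi> infnorm_pos_lt[of b] by (force simp: mult_le_0_iff)
    then show False using c wbc w(1) by (simp add: zero_prod_def)
  qed
  ultimately have c: "c > 0" by simp
  define v where "v = b /\<^sub>R c"
  show thesis
  proof
    show "- (a + v) \<in> normals X x'" unfolding normals_def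
    proof (intro CollectI ballI)
      fix y assume "y \<in> X"
      then have "0 \<le> b \<bullet> (y - x') + c * (a \<bullet> (y - x'))"
        using TD[of y "a \<bullet> (y - x')"] by (simp add: inner_diff_right bx')
      then have "0 \<le> c * ((a + v) \<bullet> (y - x'))"
        using c by (simp add: v_def inner_add_left distrib_left mult.assoc[symmetric])
      then show "- (a + v) \<bullet> (y - x') \<le> 0"
        using c unfolding inner_minus_left by (simp add: zero_le_mult_iff)
    qed
    show "v \<bullet> z \<le> v \<bullet> (x' - x)" if "l1norm z \<le> \<psi>" for z
      using cone[OF that] c by (simp add: v_def divide_right_mono)
    show "a + v + - (a + v) = 0" by simp
  qed
qed

text \<open>Nonnegativity of \<open>gap\<close> is also a one-step upper bound on
  \<open>f x'\<close>, which later carries integrability of \<open>f\<close> along the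
  iterates.\<close>

lemma prox_step_stationarity:
  fixes f :: "real^'n \<Rightarrow> real"
  assumes X: "closed X" "convex X" "x \<in> X" and pos: "\<psi> > 0" "\<eta> > 0" and L: "L \<ge> 0"
    and f: "\<And>u. u \<in> X \<Longrightarrow> f differentiable (at u)"
    and lip: "\<And>u v. u \<in> X \<Longrightarrow> v \<in> X \<Longrightarrow> infnorm (grad f u - grad f v) \<le> L * l1norm (u - v)"
    and step: "prox_step X (delta {z. l1norm z \<le> \<psi>}) \<eta> x g x'"
  defines "gap \<equiv> f x - f x' + L / 2 * \<psi>\<^sup>2 + infnorm (g - grad f x) * \<psi>"
  shows prox_step_gap_nonneg: "0 \<le> gap"
    and prox_step_dist_le: "dist0_infnorm (frechet_subdiff (\<lambda>y. ereal (f y) + delta X y) x')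
      \<le> L * \<psi> + \<psi> / \<eta> + infnorm (g - grad f x) + gap / \<psi>"
proof -
  define s where "s = x' - x"
  define e where "e = g - grad f x"
  have x'T: "x' \<in> trust_region X \<psi> x" using step X pos by (intro prox_step_in) auto
  then have x': "x' \<in> X" and s: "l1norm s \<le> \<psi>" by (auto simp: trust_region_def s_def)
  have opt: "0 \<le> (s + \<eta> *\<^sub>R g) \<bullet> (y - x')" if "y \<in> trust_region X \<psi> x" for y
  proof -
    have "(x - \<eta> *\<^sub>R g - x') \<bullet> (y - x') \<le> 0"
      using X pos step that x'T
      by (intro any_closest_point_dot[of "trust_region X \<psi> x"])
        (auto intro: convex_trust_region closed_trust_region prox_step_le)
    moreover have "s + \<eta> *\<^sub>R g = - (x - \<eta> *\<^sub>R g - x')" by (simp add: s_def)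
    ultimately show ?thesis by (metis inner_minus_left neg_0_le_iff_le)
  qed
  obtain n v where n: "n \<in> normals X x'" and v: "\<And>z. l1norm z \<le> \<psi> \<Longrightarrow> v \<bullet> z \<le> v \<bullet> s"
    and sum0: "s + \<eta> *\<^sub>R g + v + n = 0"
    using normals_trust_region[OF X(2,3) pos(1) x'T opt] unfolding s_def by blast
  have vs: "\<psi> * infnorm v \<le> v \<bullet> s"
    using v pos by (intro infnorm_le_of_l1ball) auto
  have ns: "0 \<le> n \<bullet> s"
  proof -
    have "n \<bullet> (x - x') \<le> 0" using n X by (simp add: normals_def)
    then show ?thesis by (simp add: s_def inner_diff_right)
  qed
  have es: "- (e \<bullet> s) \<le> infnorm e * \<psi>"
  proof -
    have "- (e \<bullet> s) \<le> infnorm e * l1norm s" using inner_le_infnorm_l1norm[of e s] by linarith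
    also have "\<dots> \<le> infnorm e * \<psi>" using s by (intro mult_left_mono infnorm_pos_le)
    finally show ?thesis .
  qed
  have s2: "(l1norm s)\<^sup>2 \<le> \<psi>\<^sup>2" using s by (intro power_mono l1norm_nonneg)
  have "f x' \<le> f x + grad f x \<bullet> s + L / 2 * (l1norm s)\<^sup>2"
    unfolding s_def using X x' by (intro descent_lemma f lip) auto
  also have "\<dots> \<le> f x + grad f x \<bullet> s + L / 2 * \<psi>\<^sup>2"
    using L s2 by (intro add_left_mono mult_left_mono) auto
  finally have desc: "- (g \<bullet> s) \<le> gap"
    using es by (simp add: gap_def e_def inner_diff_left)
  \<comment> \<open>Pairing the optimality condition with \<open>s\<close> leaves
    \<open>- \<eta> * (g \<bullet> s)\<close>, as \<open>- (s \<bullet> s)\<close> and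
    \<open>- (n \<bullet> s)\<close> are nonpositive.\<close>
  have "v = - s - \<eta> *\<^sub>R g - n" using sum0 by (simp add: algebra_simps eq_neg_iff_add_eq_0)
  then have "v \<bullet> s = - (s \<bullet> s) - \<eta> * (g \<bullet> s) - n \<bullet> s" by (simp add: inner_diff_left)
  also have "\<dots> \<le> \<eta> * gap"
    using ns inner_ge_zero[of s] mult_left_mono[OF desc, of \<eta>] pos by (simp del: inner_ge_zero)
  finally have v_gap: "\<psi> * infnorm v \<le> \<eta> * gap" using vs by simp
  moreover have "0 \<le> \<psi> * infnorm v" using pos by (simp add: infnorm_pos_le)
  ultimately show "0 \<le> gap" using pos by (smt (verit) mult_pos_neg)
  \<comment> \<open>A positive multiple of a normal is a normal. Substituting the optimality
    condition for \<open>n\<close> writes \<open>grad f x' + n'\<close> as change of gradient,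
    error, step over \<eta> and ball normal over \<eta>; each gives one summand of the
    bound.\<close>
  define n' where "n' = n /\<^sub>R \<eta>"
  have n': "n' \<in> normals X x'"
    using n pos by (simp add: normals_def n'_def zero_le_mult_iff mult_le_0_iff)
  have "dist0_infnorm (frechet_subdiff (\<lambda>y. ereal (f y) + delta X y) x') \<le> infnorm (grad f x' + n')"
    using n' by (subst frechet_subdiff_add_delta[OF X(2) x' f[OF x']]) (auto intro: dist0_infnorm_le)
  also have "grad f x' + n' = (grad f x' - grad f x) + (- e + (- ((1/\<eta>) *\<^sub>R s) + - ((1/\<eta>) *\<^sub>R v)))"
  proof -
    have "n = - s - \<eta> *\<^sub>R g - v" using sum0 by (simp add: algebra_simps eq_neg_iff_add_eq_0)
    then have "n' = - ((1/\<eta>) *\<^sub>R s) - g - (1/\<eta>) *\<^sub>R v"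
      using pos by (simp add: n'_def scaleR_diff_right inverse_eq_divide)
    then show ?thesis by (simp add: e_def)
  qed
  also have "infnorm \<dots> \<le> infnorm (grad f x' - grad f x) + (infnorm e + (infnorm s / \<eta> + infnorm v / \<eta>))"
    using pos
    by (intro order_trans[OF infnorm_triangle] add_mono order_refl) (simp_all add: infnorm_neg infnorm_mul)
  also have "\<dots> \<le> L * \<psi> + (infnorm e + (\<psi> / \<eta> + gap / \<psi>))"
  proof (intro add_mono order_refl)
    have "infnorm (grad f x' - grad f x) \<le> L * l1norm s" unfolding s_def by (intro lip x' X)
    also have "\<dots> \<le> L * \<psi>" using s L by (intro mult_left_mono)
    finally show "infnorm (grad f x' - grad f x) \<le> L * \<psi>" .
    show "infnorm s / \<eta> \<le> \<psi> / \<eta>"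
      using s pos infnorm_le_l1norm[of s] by (intro divide_right_mono) auto
    show "infnorm v / \<eta> \<le> gap / \<psi>" using v_gap pos by (simp add: field_simps)
  qed
  finally show "dist0_infnorm (frechet_subdiff (\<lambda>y. ereal (f y) + delta X y) x')
      \<le> L * \<psi> + \<psi> / \<eta> + infnorm (g - grad f x) + gap / \<psi>"
    by (simp add: e_def)
qed

section \<open>Continuity and measurability of the proximal map\<close>

text \<open>The nearby point is obtained by contracting towards the new centre.\<close>
lemma trust_region_shift:
  fixes X :: "(real^'n) set"
  assumes X: "convex X" "b \<in> X" and \<psi>: "\<psi> > 0" and u: "u \<in> trust_region X \<psi> a"
  obtains w where "w \<in> trust_region X \<psi> b" "norm (w - u) \<le> l1norm (a - b)"
proof
  define \<delta> where "\<delta> = l1norm (a - b)"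
  \<comment> \<open>Seen from the new centre \<open>b\<close>, the point \<open>u\<close> lies
    within \<open>\<psi> + \<delta>\<close>; this factor rescales that radius to \<psi>.\<close>
  define \<theta> where "\<theta> = \<psi> / (\<psi> + \<delta>)"
  define w where "w = (1 - \<theta>) *\<^sub>R b + \<theta> *\<^sub>R u"
  have \<delta>: "\<delta> \<ge> 0" by (simp add: \<delta>_def l1norm_nonneg)
  have \<theta>: "0 \<le> \<theta>" "\<theta> \<le> 1" using \<psi> \<delta> by (auto simp: \<theta>_def)
  have ub: "l1norm (u - b) \<le> \<psi> + \<delta>"
    using u l1norm_triangle[of "u - a" "a - b"] by (auto simp: trust_region_def \<delta>_def)
  have "w \<in> X" unfolding w_def using u X \<theta>
    by (intro convexD_alt[OF X(1)]) (auto simp: trust_region_def)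
  moreover have "l1norm (w - b) \<le> \<psi>"
  proof -
    have "w - b = \<theta> *\<^sub>R (u - b)" by (simp add: w_def algebra_simps)
    then have "l1norm (w - b) = \<theta> * l1norm (u - b)" using \<theta> by (simp add: l1norm_scaleR)
    also have "\<dots> \<le> \<theta> * (\<psi> + \<delta>)" using ub \<theta> by (intro mult_left_mono)
    also have "\<dots> = \<psi>" using \<psi> \<delta> by (simp add: \<theta>_def)
    finally show ?thesis .
  qed
  ultimately show "w \<in> trust_region X \<psi> b" by (simp add: trust_region_def)
  have "w - u = (\<theta> - 1) *\<^sub>R (u - b)" by (simp add: w_def algebra_simps)
  then have "norm (w - u) = (1 - \<theta>) * norm (u - b)" using \<theta> by simp
  also have "\<dots> \<le> (1 - \<theta>) * (\<psi> + \<delta>)"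
    using ub norm_le_l1norm[of "u - b"] \<theta> by (intro mult_left_mono) auto
  also have "\<dots> = \<delta>" using \<psi> \<delta> by (simp add: \<theta>_def field_simps)
  finally show "norm (w - u) \<le> l1norm (a - b)" by (simp add: \<delta>_def)
qed

text \<open>With an indicator as proximal function the step is a Euclidean projection onto a set
  that moves with the iterate. Centre and projected point form a pair because continuity is needed
  in both jointly.\<close>

definition prox_map :: "(real^'n) set \<Rightarrow> real \<Rightarrow> (real^'n) \<times> (real^'n) \<Rightarrow> real^'n" where
  "prox_map X \<psi> p = closest_point (trust_region X \<psi> (fst p)) (snd p)"

lemma prox_step_eq_prox_map:
  assumes X: "closed X" "convex X" "x \<in> X" and \<psi>: "\<psi> \<ge> 0"
    and step: "prox_step X (delta {z. l1norm z \<le> \<psi>}) \<eta> x g x'"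
  shows "x' = prox_map X \<psi> (x, x - \<eta> *\<^sub>R g)"
  unfolding prox_map_def
  using prox_step_in[OF step] prox_step_le[OF step] X \<psi>
  by (auto intro!: closest_point_unique convex_trust_region closed_trust_region)

text \<open>Each projection satisfies a variational inequality only over its own set. Testing it
  with the point of that set near the other projection, from \<open>trust_region_shift\<close>,
  costs a multiple of the distance of the centres; adding both inequalities bounds the squared
  distance of the projections.\<close>

lemma prox_map_dist_le:
  fixes X :: "(real^'n) set"
  assumes X: "closed X" "convex X" and \<psi>: "\<psi> > 0" and ab: "a \<in> X" "b \<in> X"
  shows "(norm (prox_map X \<psi> (a, p) - prox_map X \<psi> (b, q)))\<^sup>2
    \<le> norm (p - q) * (2 * \<psi> + l1norm (a - b)) + l1norm (a - b) * (norm (p - a) + norm (q - b) + 2 * \<psi>)"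
proof -
  define y where "y = prox_map X \<psi> (a, p)"
  define z where "z = prox_map X \<psi> (b, q)"
  define \<delta> where "\<delta> = l1norm (a - b)"
  have \<delta>: "\<delta> \<ge> 0" by (simp add: \<delta>_def l1norm_nonneg)
  have ne: "trust_region X \<psi> u \<noteq> {}" if "u \<in> X" for u
    using center_in_trust_region[of u X \<psi>] that \<psi> by auto
  have y: "y \<in> trust_region X \<psi> a" and z: "z \<in> trust_region X \<psi> b"
    unfolding y_def z_def prox_map_def using X ab
    by (auto intro!: closest_point_in_set closed_trust_region ne)
  have ya: "norm (a - y) \<le> \<psi>" and zb: "norm (z - b) \<le> \<psi>"
    using y z norm_le_l1norm[of "y - a"] norm_le_l1norm[of "z - b"]
    by (auto simp: trust_region_def norm_minus_commute)
  have yvar: "(p - y) \<bullet> (u - y) \<le> 0" if "u \<in> trust_region X \<psi> a" for u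
    unfolding y_def prox_map_def using X that
    by (auto intro!: closest_point_dot closed_trust_region convex_trust_region)
  have zvar: "(q - z) \<bullet> (u - z) \<le> 0" if "u \<in> trust_region X \<psi> b" for u
    unfolding z_def prox_map_def using X that
    by (auto intro!: closest_point_dot closed_trust_region convex_trust_region)
  obtain w where w: "w \<in> trust_region X \<psi> a" "norm (w - z) \<le> \<delta>"
    using trust_region_shift[OF X(2) ab(1) \<psi> z] by (auto simp: \<delta>_def l1norm_minus_commute)
  obtain w' where w': "w' \<in> trust_region X \<psi> b" "norm (w' - y) \<le> \<delta>"
    using trust_region_shift[OF X(2) ab(2) \<psi> y] by (auto simp: \<delta>_def)
  have 1: "(p - y) \<bullet> (z - y) \<le> norm (p - y) * \<delta>"
  proof -
    have "(p - y) \<bullet> (z - y) = (p - y) \<bullet> (w - y) - (p - y) \<bullet> (w - z)" by (simp add: inner_diff_right)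
    also have "\<dots> \<le> 0 + norm (p - y) * norm (w - z)"
      using yvar[OF w(1)] Cauchy_Schwarz_ineq2[of "p - y" "w - z"] by linarith
    also have "\<dots> \<le> norm (p - y) * \<delta>" using w(2) by (simp add: mult_left_mono)
    finally show ?thesis .
  qed
  have 2: "(q - z) \<bullet> (y - z) \<le> norm (q - z) * \<delta>"
  proof -
    have "(q - z) \<bullet> (y - z) = (q - z) \<bullet> (w' - z) - (q - z) \<bullet> (w' - y)" by (simp add: inner_diff_right)
    also have "\<dots> \<le> 0 + norm (q - z) * norm (w' - y)"
      using zvar[OF w'(1)] Cauchy_Schwarz_ineq2[of "q - z" "w' - y"] by linarith
    also have "\<dots> \<le> norm (q - z) * \<delta>" using w'(2) by (simp add: mult_left_mono)
    finally show ?thesis .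
  qed
  have "(norm (y - z))\<^sup>2 = (p - y) \<bullet> (z - y) + (q - z) \<bullet> (y - z) + (p - q) \<bullet> (y - z)"
    by (simp add: power2_norm_eq_inner inner_diff_left inner_diff_right inner_commute)
  also have "\<dots> \<le> norm (p - y) * \<delta> + norm (q - z) * \<delta> + norm (p - q) * norm (y - z)"
    by (intro add_mono 1 2 norm_cauchy_schwarz)
  also have "\<dots> \<le> (norm (p - a) + \<psi>) * \<delta> + (norm (q - b) + \<psi>) * \<delta> + norm (p - q) * (2 * \<psi> + \<delta>)"
  proof (intro add_mono mult_right_mono mult_left_mono \<delta> norm_ge_zero)
    show "norm (p - y) \<le> norm (p - a) + \<psi>"
      using norm_triangle_ineq[of "p - a" "a - y"] ya by simp
    show "norm (q - z) \<le> norm (q - b) + \<psi>"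
      using norm_triangle_ineq4[of "q - b" "z - b"] zb by simp
    have "norm (y - z) \<le> norm (a - y) + norm (a - b) + norm (z - b)"
      using norm_triangle_ineq4[of "a - b" "a - y"] norm_triangle_ineq4[of "(a - b) - (a - y)" "z - b"]
      by (simp add: algebra_simps)
    then show "norm (y - z) \<le> 2 * \<psi> + \<delta>"
      using ya zb norm_le_l1norm[of "a - b"] by (simp add: \<delta>_def)
  qed
  finally show ?thesis by (simp add: y_def z_def \<delta>_def algebra_simps)
qed

lemma continuous_on_prox_map:
  fixes X :: "(real^'n) set"
  assumes X: "closed X" "convex X" and \<psi>: "\<psi> > 0"
  shows "continuous_on (X \<times> UNIV) (prox_map X \<psi>)"
  unfolding continuous_on_def
proof
  fix s assume s: "s \<in> X \<times> (UNIV :: (real^'n) set)"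
  define B where "B r = norm (snd r - snd s) * (2 * \<psi> + l1norm (fst r - fst s))
    + l1norm (fst r - fst s) * (norm (snd r - fst r) + norm (snd s - fst s) + 2 * \<psi>)" for r
  have "continuous_on (X \<times> UNIV) B" unfolding B_def by (intro continuous_intros)
  then have "(B \<longlongrightarrow> B s) (at s within X \<times> UNIV)" using s unfolding continuous_on_def by blast
  moreover have "B s = 0" by (simp add: B_def)
  ultimately have "((\<lambda>r. sqrt (B r)) \<longlongrightarrow> sqrt 0) (at s within X \<times> UNIV)"
    by (intro tendsto_real_sqrt) simp
  then have lim: "((\<lambda>r. sqrt (B r)) \<longlongrightarrow> 0) (at s within X \<times> UNIV)" by simp
  have "((\<lambda>r. dist (prox_map X \<psi> r) (prox_map X \<psi> s)) \<longlongrightarrow> 0) (at s within X \<times> UNIV)"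
  proof (rule tendsto_sandwich[OF _ _ tendsto_const lim])
    have "dist (prox_map X \<psi> r) (prox_map X \<psi> s) \<le> sqrt (B r)" if "r \<in> X \<times> UNIV" for r
    proof -
      have "(norm (prox_map X \<psi> r - prox_map X \<psi> s))\<^sup>2 \<le> B r"
        using prox_map_dist_le[OF X \<psi>, of "fst r" "fst s" "snd r" "snd s"] that s
        by (simp add: B_def mem_Times_iff)
      then show ?thesis by (simp add: dist_norm real_le_rsqrt)
    qed
    then show "\<forall>\<^sub>F r in at s within X \<times> UNIV. dist (prox_map X \<psi> r) (prox_map X \<psi> s) \<le> sqrt (B r)"
      by (auto simp: eventually_at_filter)
  qed auto
  then show "(prox_map X \<psi> \<longlongrightarrow> prox_map X \<psi> s) (at s within X \<times> UNIV)"
    by (rule tendsto_dist_iff[THEN iffD2])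
qed

lemma borel_measurable_prox_map:
  fixes U V :: "'w \<Rightarrow> real^'n"
  assumes X: "closed X" "convex X" and \<psi>: "\<psi> > 0"
    and U: "U \<in> borel_measurable M" and V: "V \<in> borel_measurable M"
    and inX: "\<And>\<omega>. \<omega> \<in> space M \<Longrightarrow> U \<omega> \<in> X"
  shows "(\<lambda>\<omega>. prox_map X \<psi> (U \<omega>, V \<omega>)) \<in> borel_measurable M"
proof -
  \<comment> \<open>Continuity is known on the closed set \<open>X \<times> UNIV\<close>, so the map
    is cut off by its indicator.\<close>
  have [measurable]: "(\<lambda>p. indicator (X \<times> UNIV) p *\<^sub>R prox_map X \<psi> p) \<in> borel_measurable borel"
    using X \<psi> by (intro borel_measurable_continuous_on_indicator continuous_on_prox_map
        borel_closed closed_Times) auto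
  have "(\<lambda>\<omega>. indicator (X \<times> UNIV) (U \<omega>, V \<omega>) *\<^sub>R prox_map X \<psi> (U \<omega>, V \<omega>)) \<in> borel_measurable M"
    using U V by measurable
  then show ?thesis
    by (rule measurable_cong[THEN iffD1, rotated]) (simp add: inX)
qed

section \<open>Measurability and independence\<close>

lemma borel_measurable_vec_nth [measurable (raw)]:
  fixes g :: "'a \<Rightarrow> real^'n"
  shows "g \<in> borel_measurable M \<Longrightarrow> (\<lambda>x. g x $ i) \<in> borel_measurable M"
  by (rule borel_measurable_continuous_on[of "\<lambda>x. x $ i"]) (intro continuous_intros)

text \<open>Round the first argument down to the grid of mesh \<open>1 / (k + 1)\<close>. Countably
  many cells make the rounded function measurable, and continuity in the first argument gives
  pointwise convergence.\<close>

lemma borel_measurable_caratheodory: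
  fixes F :: "real^'n \<Rightarrow> 'z \<Rightarrow> real"
  assumes meas [measurable]: "\<And>y. F y \<in> borel_measurable D"
    and cont: "\<And>z. z \<in> space D \<Longrightarrow> continuous_on UNIV (\<lambda>u. F u z)"
  shows "(\<lambda>p. F (fst p) (snd p)) \<in> borel_measurable (borel \<Otimes>\<^sub>M D)"
proof -
  define cell :: "nat \<Rightarrow> real^'n \<Rightarrow> int^'n" where "cell k u = (\<chi> i. \<lfloor>real (Suc k) * u $ i\<rfloor>)" for k u
  define corner :: "nat \<Rightarrow> int^'n \<Rightarrow> real^'n" where "corner k c = (\<chi> i. real_of_int (c $ i) / real (Suc k))" for k c
  show ?thesis
  proof (rule borel_measurable_LIMSEQ_real)
    fix k
    show "(\<lambda>p. F (corner k (cell k (fst p))) (snd p)) \<in> borel_measurable (borel \<Otimes>\<^sub>M D)"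
    proof (rule measurable_compose_countable[where g = "\<lambda>p. cell k (fst p)"])
      show "(\<lambda>p. F (corner k c) (snd p)) \<in> borel_measurable (borel \<Otimes>\<^sub>M D)" for c
        by measurable
      have "(\<lambda>p. cell k (fst p)) -` {c} \<inter> space (borel \<Otimes>\<^sub>M D) \<in> sets (borel \<Otimes>\<^sub>M D)" for c
      proof -
        have "(\<lambda>p. cell k (fst p)) -` {c} \<inter> space (borel \<Otimes>\<^sub>M D)
            = {p \<in> space (borel \<Otimes>\<^sub>M D). \<forall>i. \<lfloor>real (Suc k) * fst p $ i\<rfloor> = c $ i}"
          by (auto simp: cell_def vec_eq_iff)
        also have "\<dots> \<in> sets (borel \<Otimes>\<^sub>M D)" by measurable
        finally show ?thesis .
      qed
      then show "(\<lambda>p. cell k (fst p)) \<in> borel \<Otimes>\<^sub>M D \<rightarrow>\<^sub>M count_space UNIV"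
        by (simp add: measurable_count_space_eq2_countable)
    qed
  next
    fix p assume "p \<in> space (borel \<Otimes>\<^sub>M D :: ((real^'n) \<times> 'z) measure)"
    then have z: "snd p \<in> space D" by (auto simp: space_pair_measure)
    have "(\<lambda>k. corner k (cell k (fst p))) \<longlonglongrightarrow> fst p"
    proof (rule vec_tendstoI)
      fix i
      define t where "t = fst p $ i"
      have "(\<lambda>k. real_of_int \<lfloor>real (Suc k) * t\<rfloor> / real (Suc k)) \<longlonglongrightarrow> t"
      proof (rule tendsto_sandwich)
        show "\<forall>\<^sub>F k in sequentially. t - inverse (real (Suc k)) \<le> real_of_int \<lfloor>real (Suc k) * t\<rfloor> / real (Suc k)"
        proof (intro always_eventually allI)
          fix k
          have "real (Suc k) * t - 1 \<le> real_of_int \<lfloor>real (Suc k) * t\<rfloor>" by linarith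
          then have "(real (Suc k) * t - 1) / real (Suc k) \<le> real_of_int \<lfloor>real (Suc k) * t\<rfloor> / real (Suc k)"
            by (intro divide_right_mono) auto
          then show "t - inverse (real (Suc k)) \<le> real_of_int \<lfloor>real (Suc k) * t\<rfloor> / real (Suc k)"
            by (simp add: diff_divide_distrib inverse_eq_divide del: of_nat_Suc)
        qed
        show "\<forall>\<^sub>F k in sequentially. real_of_int \<lfloor>real (Suc k) * t\<rfloor> / real (Suc k) \<le> t"
          by (intro always_eventually allI) (simp add: pos_divide_le_eq mult.commute del: of_nat_Suc)
        show "(\<lambda>k. t - inverse (real (Suc k))) \<longlonglongrightarrow> t"
          using tendsto_diff[OF tendsto_const LIMSEQ_inverse_real_of_nat, of t] by simp
      qed simp
      then show "(\<lambda>k. corner k (cell k (fst p)) $ i) \<longlonglongrightarrow> fst p $ i"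
        by (simp add: corner_def cell_def t_def)
    qed
    then show "(\<lambda>k. F (corner k (cell k (fst p))) (snd p)) \<longlonglongrightarrow> F (fst p) (snd p)"
      by (rule continuous_on_tendsto_compose[OF cont[OF z]]) auto
  qed
qed

text \<open>Components of the gradient are pointwise limits of difference quotients with steps
  \<open>1 / (k + 1)\<close>, and each quotient is jointly measurable because \<open>F\<close>
  is.\<close>

lemma borel_measurable_grad_pair:
  fixes F :: "real^'n \<Rightarrow> 'z \<Rightarrow> real"
  assumes meas: "\<And>y. F y \<in> borel_measurable D"
    and diff: "\<And>y z. z \<in> space D \<Longrightarrow> (\<lambda>u. F u z) differentiable (at y)"
  shows "(\<lambda>p. grad (\<lambda>u. F u (snd p)) (fst p)) \<in> borel_measurable (borel \<Otimes>\<^sub>M D)"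
proof (rule borel_measurable_euclidean_space[THEN iffD2], rule ballI)
  fix b :: "real^'n"
  have [measurable]: "(\<lambda>p. F (fst p) (snd p)) \<in> borel_measurable (borel \<Otimes>\<^sub>M D)"
  proof (rule borel_measurable_caratheodory[OF meas])
    show "continuous_on UNIV (\<lambda>u. F u z)" if "z \<in> space D" for z
      using diff[OF that] differentiable_imp_continuous_on[of "\<lambda>u. F u z" UNIV]
      by (simp add: differentiable_on_def)
  qed
  have shift: "(\<lambda>p. F (fst p + c *\<^sub>R b) (snd p)) \<in> borel_measurable (borel \<Otimes>\<^sub>M D)" for c
  proof -
    have "(\<lambda>p. (fst p + c *\<^sub>R b, snd p)) \<in> borel \<Otimes>\<^sub>M D \<rightarrow>\<^sub>M borel \<Otimes>\<^sub>M D" by measurable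
    from measurable_compose[OF this, of "\<lambda>p. F (fst p) (snd p)"] show ?thesis by simp
  qed
  show "(\<lambda>p. grad (\<lambda>u. F u (snd p)) (fst p) \<bullet> b) \<in> borel_measurable (borel \<Otimes>\<^sub>M D)"
  proof (rule borel_measurable_LIMSEQ_real)
    fix k
    note [measurable] = shift
    show "(\<lambda>p. (F (fst p + inverse (real (Suc k)) *\<^sub>R b) (snd p) - F (fst p) (snd p)) / inverse (real (Suc k)))
        \<in> borel_measurable (borel \<Otimes>\<^sub>M D)"
      by measurable
  next
    fix p assume "p \<in> space (borel \<Otimes>\<^sub>M D :: ((real^'n) \<times> 'z) measure)"
    then have z: "snd p \<in> space D" by (auto simp: space_pair_measure)
    have "((\<lambda>s. F (fst p + s *\<^sub>R b) (snd p)) has_real_derivative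
        b \<bullet> grad (\<lambda>u. F u (snd p)) (fst p)) (at 0)"
      by (rule gderiv_along_line) (simp add: gderiv_grad diff z)
    then have "((\<lambda>s. (F (fst p + s *\<^sub>R b) (snd p) - F (fst p) (snd p)) / s)
        \<longlongrightarrow> b \<bullet> grad (\<lambda>u. F u (snd p)) (fst p)) (at 0)"
      by (simp add: has_field_derivative_iff)
    moreover have "filterlim (\<lambda>k. inverse (real (Suc k))) (at 0) sequentially"
      unfolding filterlim_at using LIMSEQ_inverse_real_of_nat by auto
    ultimately have "(\<lambda>k. (F (fst p + inverse (real (Suc k)) *\<^sub>R b) (snd p) - F (fst p) (snd p)) / inverse (real (Suc k)))
        \<longlonglongrightarrow> b \<bullet> grad (\<lambda>u. F u (snd p)) (fst p)"
      by (rule filterlim_compose)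
    then show "(\<lambda>k. (F (fst p + inverse (real (Suc k)) *\<^sub>R b) (snd p) - F (fst p) (snd p)) / inverse (real (Suc k)))
        \<longlonglongrightarrow> grad (\<lambda>u. F u (snd p)) (fst p) \<bullet> b"
      by (simp only: inner_commute)
  qed
qed

lemma borel_measurable_grad:
  fixes f :: "real^'n \<Rightarrow> real"
  assumes "\<And>y. f differentiable (at y)"
  shows "grad f \<in> borel_measurable borel"
proof -
  \<comment> \<open>The parameter space is a dummy: \<open>f\<close> is viewed as a family that does
    not depend on \<open>z\<close>.\<close>
  have "(\<lambda>p. grad (\<lambda>u. f u) (fst p)) \<in> borel_measurable (borel \<Otimes>\<^sub>M (borel :: real measure))"
    using borel_measurable_grad_pair[of "\<lambda>u z :: real. f u" borel] assms by simp
  from measurable_compose[OF _ this, of "\<lambda>u. (u, 0)" borel]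
  show ?thesis by simp
qed

section \<open>Moments in the max-norm, and product laws from independence\<close>

lemma l1norm_le_infnorm: "l1norm (x :: real^'n) \<le> real CARD('n) * infnorm x"
proof -
  have "l1norm x \<le> (\<Sum>i\<in>(UNIV :: 'n set). infnorm x)"
    unfolding l1norm_def by (intro sum_mono abs_nth_le_infnorm)
  then show ?thesis by simp
qed

lemma borel_measurable_infnorm [measurable (raw)]:
  fixes g :: "'a \<Rightarrow> real^'n"
  shows "g \<in> borel_measurable M \<Longrightarrow> (\<lambda>x. infnorm (g x)) \<in> borel_measurable M"
  by (rule borel_measurable_continuous_on[of infnorm]) (intro continuous_intros)

text \<open>Jensen for the squared max-norm: at a coordinate where the mean attains its max-norm,
  the claim reduces to nonnegativity of a variance.\<close>

lemma (in prob_space) infnorm_expectation_sq_le: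
  fixes g :: "'a \<Rightarrow> real^'n"
  assumes g: "integrable M g" and sq: "integrable M (\<lambda>x. (infnorm (g x))\<^sup>2)"
  shows "(infnorm (expectation g))\<^sup>2 \<le> expectation (\<lambda>x. (infnorm (g x))\<^sup>2)"
proof -
  obtain i where i: "infnorm (expectation g) = \<bar>expectation g $ i\<bar>" using infnorm_attained by blast
  have le: "(g x $ i)\<^sup>2 \<le> (infnorm (g x))\<^sup>2" for x
    using abs_nth_le_infnorm[of "g x" i] by (simp add: abs_le_square_iff[symmetric] real_abs_infnorm)
  have gi: "integrable M (\<lambda>x. g x $ i)"
    using integrable_inner_left[OF g, of "axis i 1"] by (simp add: inner_axis)
  have gi2: "integrable M (\<lambda>x. (g x $ i)\<^sup>2)"
    using gi by (intro Bochner_Integration.integrable_bound[OF sq]) (auto simp: le)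
  have "expectation g $ i = expectation (\<lambda>x. g x $ i)"
    using integral_inner_left[OF g, of "axis i 1"] by (simp add: inner_axis)
  then have "(infnorm (expectation g))\<^sup>2 = (expectation (\<lambda>x. g x $ i))\<^sup>2" by (simp add: i)
  also have "\<dots> \<le> expectation (\<lambda>x. (g x $ i)\<^sup>2)"
    using variance_eq[OF gi gi2] variance_positive[of "\<lambda>x. g x $ i"] by simp
  also have "\<dots> \<le> expectation (\<lambda>x. (infnorm (g x))\<^sup>2)"
    by (intro integral_mono gi2 sq le)
  finally show ?thesis .
qed

text \<open>Sources are grouped into \<open>J\<close> and \<open>{s}\<close>; whatever the group
  \<open>J\<close> determines is independent of a variable determined by \<open>s\<close>. The
  conclusion is a product law, the form in which Fubini applies.\<close>

lemma (in prob_space) indep_sets_distr_pair: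
  assumes indep: "indep_sets E I" and stable: "\<And>s. s \<in> I \<Longrightarrow> Int_stable (E s)"
    and J: "J \<subseteq> I" and s: "s \<in> I" "s \<notin> J"
    and U: "U \<in> measurable (sigma (space M) (\<Union>s\<in>J. E s)) N"
    and Z: "Z \<in> measurable M D" "\<And>A. A \<in> sets D \<Longrightarrow> Z -` A \<inter> space M \<in> E s"
  shows "distr M (N \<Otimes>\<^sub>M D) (\<lambda>\<omega>. (U \<omega>, Z \<omega>)) = distr M N U \<Otimes>\<^sub>M distr M D Z"
proof -
  have ev: "E s \<subseteq> events" if "s \<in> I" for s using indep that by (auto simp: indep_sets_def)
  have sub: "(\<Union>s\<in>J. E s) \<subseteq> Pow (space M)" using ev J sets.sets_into_space by blast
  have "sigma_sets (space M) (\<Union>s\<in>J. E s) \<subseteq> events"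
    using ev J by (intro sets.sigma_sets_subset) blast
  then have UM [measurable]: "U \<in> measurable M N"
    using U sub by (auto simp: measurable_def space_measure_of sets_measure_of)
  note Z(1) [measurable]
  define b where "b j = (if j then J else {s})" for j :: bool
  have ind: "indep_sets (\<lambda>j. sigma_sets (space M) (\<Union>i\<in>b j. E i)) UNIV"
  proof (rule indep_sets_collect_sigma)
    show "indep_sets E (\<Union>j. b j)"
      using indep by (rule indep_sets_mono_index[rotated]) (use J s in \<open>auto simp: b_def split: if_splits\<close>)
    show "Int_stable (E i)" if "i \<in> b j" for i j
      using that J s by (intro stable) (auto simp: b_def split: if_splits)
    show "disjoint_family_on b UNIV"
      using s by (auto simp: disjoint_family_on_def b_def)
  qed
  have "distr M N U \<Otimes>\<^sub>M distr M D Z = distr M (N \<Otimes>\<^sub>M D) (\<lambda>\<omega>. (U \<omega>, Z \<omega>))"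
  proof (rule pair_measure_eqI)
    show "sigma_finite_measure (distr M N U)" "sigma_finite_measure (distr M D Z)"
      by (intro prob_space_imp_sigma_finite prob_space_distr; measurable)+
    fix A B assume AB: "A \<in> sets (distr M N U)" "B \<in> sets (distr M D Z)"
    then have [measurable]: "A \<in> sets N" "B \<in> sets D" by auto
    have 1: "U -` A \<inter> space M \<in> sigma_sets (space M) (\<Union>i\<in>b True. E i)"
      using measurable_sets[OF U, of A] AB sub by (simp add: b_def)
    have 2: "Z -` B \<inter> space M \<in> sigma_sets (space M) (\<Union>i\<in>b False. E i)"
      using Z(2) AB by (auto simp: b_def)
    have "prob ((U -` A \<inter> space M) \<inter> (Z -` B \<inter> space M)) = prob (U -` A \<inter> space M) * prob (Z -` B \<inter> space M)"
      using indep_setsD[OF ind, of UNIV "case_bool (U -` A \<inter> space M) (Z -` B \<inter> space M)"] 1 2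
      by (simp add: UNIV_bool Ball_def ac_simps split: bool.split)
    moreover have "(\<lambda>\<omega>. (U \<omega>, Z \<omega>)) -` (A \<times> B) \<inter> space M = (U -` A \<inter> space M) \<inter> (Z -` B \<inter> space M)"
      by auto
    ultimately show "emeasure (distr M N U) A * emeasure (distr M D Z) B
        = emeasure (distr M (N \<Otimes>\<^sub>M D) (\<lambda>\<omega>. (U \<omega>, Z \<omega>))) (A \<times> B)"
      by (simp add: emeasure_distr emeasure_eq_measure ennreal_mult)
  qed simp
  then show ?thesis ..
qed

section \<open>Integrating out a fresh independent sample\<close>

context prob_space
begin

context
  fixes N :: "'u measure" and D :: "'z measure" and U :: "'a \<Rightarrow> 'u" and Z :: "'a \<Rightarrow> 'z"
  assumes U [measurable]: "U \<in> measurable M N" and Z [measurable]: "Z \<in> measurable M D"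
    and distr_pair: "distr M (N \<Otimes>\<^sub>M D) (\<lambda>\<omega>. (U \<omega>, Z \<omega>)) = distr M N U \<Otimes>\<^sub>M D"
    and D: "prob_space D"
begin

lemma indep_nn_integral:
  assumes h: "h \<in> borel_measurable (N \<Otimes>\<^sub>M D)"
  shows "(\<integral>\<^sup>+\<omega>. h (U \<omega>, Z \<omega>) \<partial>M) = (\<integral>\<^sup>+\<omega>. \<integral>\<^sup>+z. h (U \<omega>, z) \<partial>D \<partial>M)"
proof -
  interpret D: prob_space D by (rule D)
  note [measurable] = h
  have "(\<integral>\<^sup>+\<omega>. h (U \<omega>, Z \<omega>) \<partial>M) = (\<integral>\<^sup>+p. h p \<partial>distr M (N \<Otimes>\<^sub>M D) (\<lambda>\<omega>. (U \<omega>, Z \<omega>)))"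
    by (subst nn_integral_distr) auto
  also have "\<dots> = (\<integral>\<^sup>+u. \<integral>\<^sup>+z. h (u, z) \<partial>D \<partial>distr M N U)"
    unfolding distr_pair by (subst D.nn_integral_fst) auto
  also have "\<dots> = (\<integral>\<^sup>+\<omega>. \<integral>\<^sup>+z. h (U \<omega>, z) \<partial>D \<partial>M)"
    by (subst nn_integral_distr) auto
  finally show ?thesis .
qed

lemma indep_integral:
  fixes h :: "'u \<times> 'z \<Rightarrow> real"
  assumes h: "h \<in> borel_measurable (N \<Otimes>\<^sub>M D)" and int: "integrable M (\<lambda>\<omega>. h (U \<omega>, Z \<omega>))"
  shows "(\<integral>\<omega>. h (U \<omega>, Z \<omega>) \<partial>M) = (\<integral>\<omega>. (\<integral>z. h (U \<omega>, z) \<partial>D) \<partial>M)"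
proof -
  interpret D: prob_space D by (rule D)
  interpret N: prob_space "distr M N U" by (rule prob_space_distr) measurable
  interpret P: pair_prob_space "distr M N U" D ..
  note [measurable] = h
  have "integrable (distr M N U \<Otimes>\<^sub>M D) h"
    unfolding distr_pair[symmetric] using int by (subst integrable_distr_eq) auto
  then have fub: "(\<integral>u. (\<integral>z. h (u, z) \<partial>D) \<partial>distr M N U) = (\<integral>p. h p \<partial>(distr M N U \<Otimes>\<^sub>M D))"
    by (rule P.integral_fst')
  have "(\<integral>\<omega>. h (U \<omega>, Z \<omega>) \<partial>M) = (\<integral>p. h p \<partial>distr M (N \<Otimes>\<^sub>M D) (\<lambda>\<omega>. (U \<omega>, Z \<omega>)))"
    by (subst integral_distr) auto
  also have "\<dots> = (\<integral>u. (\<integral>z. h (u, z) \<partial>D) \<partial>distr M N U)"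
    unfolding distr_pair fub ..
  also have "\<dots> = (\<integral>\<omega>. (\<integral>z. h (U \<omega>, z) \<partial>D) \<partial>M)"
    by (subst integral_distr) auto
  finally show ?thesis .
qed

text \<open>With the past \<open>U\<close> frozen, the linear term of \<open>pot_add_le\<close>
  integrates to \<open>0\<close> over the fresh sample, and the squared max-norm of the increment to
  at most \<open>a^2 * c\<close>. This is the substitute for orthogonality of increments.\<close>

lemma pot_step:
  fixes v :: "'u \<Rightarrow> real^'n" and w :: "'u \<times> 'z \<Rightarrow> real^'n"
  assumes \<delta>: "\<delta> > 0" and r: "r \<ge> 1" and card: "real CARD('n) \<le> 2 ^ (r - 1)"
    and v [measurable]: "v \<in> borel_measurable N" and w [measurable]: "w \<in> borel_measurable (N \<Otimes>\<^sub>M D)"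
    and mean: "\<And>\<omega>. \<omega> \<in> space M \<Longrightarrow> has_bochner_integral D (\<lambda>z. w (U \<omega>, z)) 0"
    and second: "\<And>\<omega>. \<omega> \<in> space M \<Longrightarrow> integrable D (\<lambda>z. (infnorm (w (U \<omega>, z)))\<^sup>2)"
      "\<And>\<omega>. \<omega> \<in> space M \<Longrightarrow> (\<integral>z. (infnorm (w (U \<omega>, z)))\<^sup>2 \<partial>D) \<le> c"
    and c: "c \<ge> 0"
    and int: "integrable M (\<lambda>\<omega>. pot r \<delta> (v (U \<omega>)))"
  shows "integrable M (\<lambda>\<omega>. pot r \<delta> (v (U \<omega>) + a *\<^sub>R w (U \<omega>, Z \<omega>)))" (is ?int)
    and "expectation (\<lambda>\<omega>. pot r \<delta> (v (U \<omega>) + a *\<^sub>R w (U \<omega>, Z \<omega>)))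
      \<le> expectation (\<lambda>\<omega>. pot r \<delta> (v (U \<omega>))) + 3 * (2 * real r - 1) * (a\<^sup>2 * c)" (is ?le)
proof -
  have [measurable]: "pot r \<delta> \<in> borel_measurable borel" "pot_grad r \<delta> \<in> borel_measurable borel"
    using \<delta> by (auto intro!: borel_measurable_continuous_onI continuous_on_pot continuous_on_pot_grad)
  define H where "H \<omega> = pot_grad r \<delta> (v (U \<omega>))" for \<omega>
  define W where "W \<omega> = w (U \<omega>, Z \<omega>)" for \<omega>
  have [measurable]: "W \<in> borel_measurable M" "H \<in> borel_measurable M"
    unfolding W_def H_def by measurable
  have "(\<integral>\<^sup>+\<omega>. ennreal ((infnorm (W \<omega>))\<^sup>2) \<partial>M)
      = (\<integral>\<^sup>+\<omega>. \<integral>\<^sup>+z. ennreal ((infnorm (w (U \<omega>, z)))\<^sup>2) \<partial>D \<partial>M)"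
    unfolding W_def by (rule indep_nn_integral) measurable
  also have "\<dots> \<le> (\<integral>\<^sup>+\<omega>. ennreal c \<partial>M)"
    by (intro nn_integral_mono) (simp add: nn_integral_eq_integral second ennreal_leI)
  also have "\<dots> = ennreal c" by (simp add: emeasure_space_1)
  finally have nn: "(\<integral>\<^sup>+\<omega>. ennreal ((infnorm (W \<omega>))\<^sup>2) \<partial>M) \<le> ennreal c" .
  then have W2: "integrable M (\<lambda>\<omega>. (infnorm (W \<omega>))\<^sup>2)"
    by (intro integrableI_nonneg) (auto simp: le_less_trans)
  have EW2: "expectation (\<lambda>\<omega>. (infnorm (W \<omega>))\<^sup>2) \<le> c"
    using nn c by (simp add: nn_integral_eq_integral[OF W2] ennreal_le_iff)
  \<comment> \<open>Fubini for the linear term requires its integrability first. The dimension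
    factor from passing to the l1-norm stays confined to this domination and does not reach the
    final estimate.\<close>
  have HW: "integrable M (\<lambda>\<omega>. H \<omega> \<bullet> W \<omega>)"
  proof (rule Bochner_Integration.integrable_bound)
    show "integrable M (\<lambda>\<omega>. real CARD('n) * (4 * pot r \<delta> (v (U \<omega>)) + (infnorm (W \<omega>))\<^sup>2))"
      by (intro integrable_mult_right Bochner_Integration.integrable_add int W2)
    have "norm (H \<omega> \<bullet> W \<omega>) \<le> norm (real CARD('n) * (4 * pot r \<delta> (v (U \<omega>)) + (infnorm (W \<omega>))\<^sup>2))" for \<omega>
    proof -
      have "\<bar>H \<omega> \<bullet> W \<omega>\<bar> \<le> infnorm (H \<omega>) * (real CARD('n) * infnorm (W \<omega>))"
        using inner_le_infnorm_l1norm mult_left_mono[OF l1norm_le_infnorm infnorm_pos_le]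
        by (rule order_trans)
      also have "\<dots> = real CARD('n) * (infnorm (H \<omega>) * infnorm (W \<omega>))" by simp
      also have "infnorm (H \<omega>) * infnorm (W \<omega>) \<le> (infnorm (H \<omega>))\<^sup>2 + (infnorm (W \<omega>))\<^sup>2"
        using sum_squares_bound[of "infnorm (H \<omega>)" "infnorm (W \<omega>)"]
          mult_nonneg_nonneg[OF infnorm_pos_le[of "H \<omega>"] infnorm_pos_le[of "W \<omega>"]]
        by linarith
      also have "\<dots> \<le> 4 * pot r \<delta> (v (U \<omega>)) + (infnorm (W \<omega>))\<^sup>2"
        unfolding H_def by (intro add_right_mono pot_grad_bound \<delta> r)
      finally have "\<bar>H \<omega> \<bullet> W \<omega>\<bar> \<le> real CARD('n) * (4 * pot r \<delta> (v (U \<omega>)) + (infnorm (W \<omega>))\<^sup>2)"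
        by (simp add: mult_left_mono)
      then show ?thesis by simp
    qed
    then show "AE \<omega> in M. norm (H \<omega> \<bullet> W \<omega>) \<le> norm (real CARD('n) * (4 * pot r \<delta> (v (U \<omega>)) + (infnorm (W \<omega>))\<^sup>2))"
      by simp
  qed measurable
  have EHW: "expectation (\<lambda>\<omega>. H \<omega> \<bullet> W \<omega>) = 0"
  proof -
    have "expectation (\<lambda>\<omega>. H \<omega> \<bullet> W \<omega>)
        = (\<integral>\<omega>. (\<integral>z. pot_grad r \<delta> (v (U \<omega>)) \<bullet> w (U \<omega>, z) \<partial>D) \<partial>M)"
      using indep_integral[of "\<lambda>p. pot_grad r \<delta> (v (fst p)) \<bullet> w p"] HW by (simp add: H_def W_def)
    also have "\<dots> = (\<integral>\<omega>. 0 \<partial>M)"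
    proof (rule Bochner_Integration.integral_cong[OF refl])
      fix \<omega> assume "\<omega> \<in> space M"
      from mean[OF this] have "integrable D (\<lambda>z. w (U \<omega>, z))" "(\<integral>z. w (U \<omega>, z) \<partial>D) = 0"
        by (auto simp: has_bochner_integral_iff)
      then show "(\<integral>z. pot_grad r \<delta> (v (U \<omega>)) \<bullet> w (U \<omega>, z) \<partial>D) = 0" by simp
    qed
    finally show ?thesis by simp
  qed
  define B where "B \<omega> = pot r \<delta> (v (U \<omega>)) + a * (H \<omega> \<bullet> W \<omega>) + 3 * (2 * real r - 1) * (a\<^sup>2 * (infnorm (W \<omega>))\<^sup>2)" for \<omega>
  have B: "integrable M B"
    unfolding B_def by (intro Bochner_Integration.integrable_add integrable_mult_right int HW W2)
  have le: "pot r \<delta> (v (U \<omega>) + a *\<^sub>R w (U \<omega>, Z \<omega>)) \<le> B \<omega>" for \<omega>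
    using pot_add_le[OF \<delta> r card, of "v (U \<omega>)" "a *\<^sub>R W \<omega>"]
    by (simp add: B_def H_def W_def infnorm_mul power_mult_distrib)
  show ?int
  proof (rule Bochner_Integration.integrable_bound[OF B])
    have "norm (pot r \<delta> (v (U \<omega>) + a *\<^sub>R w (U \<omega>, Z \<omega>))) \<le> norm (B \<omega>)" for \<omega>
      using le[of \<omega>] pot_pos[OF \<delta>, of r "v (U \<omega>) + a *\<^sub>R w (U \<omega>, Z \<omega>)"] by simp
    then show "AE \<omega> in M. norm (pot r \<delta> (v (U \<omega>) + a *\<^sub>R w (U \<omega>, Z \<omega>))) \<le> norm (B \<omega>)"
      by simp
  qed measurable
  then have "expectation (\<lambda>\<omega>. pot r \<delta> (v (U \<omega>) + a *\<^sub>R w (U \<omega>, Z \<omega>))) \<le> expectation B"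
    by (intro integral_mono B le)
  also have "\<dots> = expectation (\<lambda>\<omega>. pot r \<delta> (v (U \<omega>))) + 3 * (2 * real r - 1) * (a\<^sup>2 * expectation (\<lambda>\<omega>. (infnorm (W \<omega>))\<^sup>2))"
    unfolding B_def by (simp add: int HW W2 EHW)
  also have "\<dots> \<le> expectation (\<lambda>\<omega>. pot r \<delta> (v (U \<omega>))) + 3 * (2 * real r - 1) * (a\<^sup>2 * c)"
    using EW2 r by (intro add_left_mono mult_left_mono) auto
  finally show ?le .
qed

end

end

section \<open>The variance-reduced iteration\<close>

text \<open>The data of one run. The variance constant enters as a uniform bound, extracted from the
  supremum where the locale is interpreted.\<close>

locale variance_reduced_run = prob_space M + D: prob_space D
  for M :: "'w measure" and D :: "'z measure" +
  fixes X :: "(real^'n) set" and F :: "real^'n \<Rightarrow> 'z \<Rightarrow> real" and f :: "real^'n \<Rightarrow> real"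
    and x G :: "nat \<Rightarrow> 'w \<Rightarrow> real^'n" and \<zeta> :: "nat \<Rightarrow> nat \<Rightarrow> 'w \<Rightarrow> 'z" and Y :: "'w \<Rightarrow> nat"
    and K q0 m1 m :: nat and L \<psi> \<eta> \<sigma>sq :: real
  assumes closed_X: "closed X" and convex_X: "convex X"
    and F_meas: "\<And>y. F y \<in> borel_measurable D"
    and F_diff: "\<And>y z. z \<in> space D \<Longrightarrow> (\<lambda>u. F u z) differentiable (at y)"
    and f_diff: "\<And>y. f differentiable (at y)"
    and unbiased: "\<And>y. y \<in> X \<Longrightarrow> has_bochner_integral D (\<lambda>z. grad (\<lambda>u. F u z) y) (grad f y)"
    and var_integrable: "\<And>y. y \<in> X \<Longrightarrow>
      integrable D (\<lambda>z. (infnorm (grad (\<lambda>u. F u z) y - grad f y))\<^sup>2)"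
    and var_le: "\<And>y. y \<in> X \<Longrightarrow> (\<integral>z. (infnorm (grad (\<lambda>u. F u z) y - grad f y))\<^sup>2 \<partial>D) \<le> \<sigma>sq"
    and \<sigma>sq: "\<sigma>sq \<ge> 0"
    and L: "L \<ge> 0"
    and mean_lipschitz: "\<And>y y'. y \<in> X \<Longrightarrow> y' \<in> X \<Longrightarrow>
      integrable D (\<lambda>z. (infnorm (grad (\<lambda>u. F u z) y - grad (\<lambda>u. F u z) y'))\<^sup>2) \<and>
      (\<integral>z. (infnorm (grad (\<lambda>u. F u z) y - grad (\<lambda>u. F u z) y'))\<^sup>2 \<partial>D) \<le> L\<^sup>2 * (l1norm (y - y'))\<^sup>2"
    and pos: "q0 > 0" "m1 > 0" "m > 0" "\<psi> > 0" "\<eta> > 0"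
    and start_meas: "x 1 \<in> borel_measurable M"
    and start_in: "\<And>\<omega>. \<omega> \<in> space M \<Longrightarrow> x 1 \<omega> \<in> X"
    and sample_meas: "\<And>k i. k \<in> {1..K} \<Longrightarrow> i \<in> {1..batch q0 m1 m k} \<Longrightarrow> \<zeta> k i \<in> measurable M D"
    and sample_law: "\<And>k i. k \<in> {1..K} \<Longrightarrow> i \<in> {1..batch q0 m1 m k} \<Longrightarrow> distr M D (\<zeta> k i) = D"
    and Y_meas: "Y \<in> measurable M (count_space {1..K})"
    and indep: "indep_sets (source_events M D K (x 1) \<zeta> Y) (sources K (batch q0 m1 m))"
    and estimate: "\<And>k \<omega>. k \<in> {1..K} \<Longrightarrow> \<omega> \<in> space M \<Longrightarrow>
      G k \<omega> =
        (if [k = 1] (mod q0)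
         then (1 / real (batch q0 m1 m k)) *\<^sub>R
                (\<Sum>i = 1..batch q0 m1 m k. grad (\<lambda>u. F u (\<zeta> k i \<omega>)) (x k \<omega>))
         else (1 / real (batch q0 m1 m k)) *\<^sub>R
                (\<Sum>i = 1..batch q0 m1 m k.
                   grad (\<lambda>u. F u (\<zeta> k i \<omega>)) (x k \<omega>) - grad (\<lambda>u. F u (\<zeta> k i \<omega>)) (x (k - 1) \<omega>))
              + G (k - 1) \<omega>)"
    and update: "\<And>k \<omega>. k \<in> {1..K} \<Longrightarrow> \<omega> \<in> space M \<Longrightarrow>
      prox_step X (delta {z. l1norm z \<le> \<psi>}) \<eta> (x k \<omega>) (G k \<omega>) (x (k + 1) \<omega>)"
begin

section \<open>Sources, information, and the past of an iteration\<close>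

definition bsize :: "nat \<Rightarrow> nat" where "bsize = batch q0 m1 m"

definition gen :: "source \<Rightarrow> 'w set set" where "gen = source_events M D K (x 1) \<zeta> Y"

text \<open>A sigma-algebra packed as a measure, so that \<open>measurable\<close> can refer to it;
  only its space and its sets matter.\<close>

definition info :: "source set \<Rightarrow> 'w measure" where "info J = sigma (space M) (\<Union>s\<in>J. gen s)"

text \<open>The sources that determine \<open>x k\<close>. Samples of iteration \<open>k\<close>
  itself are excluded, hence \<open>G k\<close> belongs to \<open>past (k + 1)\<close>.
  \<open>Output\<close> never occurs, which leaves \<open>Y\<close> independent of every past up to
  \<open>K + 1\<close>.\<close>

definition past :: "nat \<Rightarrow> source set" where
  "past k = insert Start {Sample k' i | k' i. k' \<in> {1..<k} \<and> i \<in> {1..bsize k'}}"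

definition gF :: "real^'n \<Rightarrow> 'z \<Rightarrow> real^'n" where "gF y z = grad (\<lambda>u. F u z) y"

definition err :: "nat \<Rightarrow> 'w \<Rightarrow> real^'n" where "err k \<omega> = G k \<omega> - grad f (x k \<omega>)"

lemma bsize_pos: "bsize k > 0"
  using pos by (simp add: bsize_def batch_def)

lemma gen_subset: "gen s \<subseteq> Pow (space M)"
proof (cases s)
  case Start
  then show ?thesis using sets.sets_into_space[of _ "vimage_algebra (space M) (x 1) borel"]
    by (auto simp: gen_def source_events_def)
next
  case (Sample k i)
  then show ?thesis using sets.sets_into_space[of _ "vimage_algebra (space M) (\<zeta> k i) D"]
    by (auto simp: gen_def source_events_def)
next
  case Output
  then show ?thesis using sets.sets_into_space[of _ "vimage_algebra (space M) Y (count_space {1..K})"]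
    by (auto simp: gen_def source_events_def)
qed

lemma gen_stable: "Int_stable (gen s)"
  by (cases s) (auto simp: gen_def source_events_def sets.Int_stable)

lemma space_info [simp]: "space (info J) = space M"
  by (simp add: info_def space_measure_of_conv)

lemma sets_info: "sets (info J) = sigma_sets (space M) (\<Union>s\<in>J. gen s)"
  unfolding info_def using gen_subset by (intro sets_measure_of) auto

lemma gen_in_info: "s \<in> J \<Longrightarrow> A \<in> gen s \<Longrightarrow> A \<in> sets (info J)"
  unfolding sets_info by (intro sigma_sets.Basic) auto

lemma measurable_info_mono:
  assumes "J \<subseteq> J'" "U \<in> measurable (info J) N"
  shows "U \<in> measurable (info J') N"
proof -
  have "sets (info J) \<subseteq> sets (info J')"
    unfolding sets_info using assms(1) by (intro sigma_sets_mono') auto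
  then show ?thesis using assms(2) by (auto simp: measurable_def)
qed

lemma measurable_info_M:
  assumes "J \<subseteq> sources K bsize" "U \<in> measurable (info J) N"
  shows "U \<in> measurable M N"
proof -
  have "gen s \<subseteq> events" if "s \<in> sources K bsize" for s
    using indep that by (auto simp: indep_sets_def gen_def bsize_def)
  then have "sets (info J) \<subseteq> events"
    unfolding sets_info using assms(1) by (intro sets.sigma_sets_subset) blast
  then show ?thesis using assms(2) by (auto simp: measurable_def)
qed

lemma start_info: "Start \<in> J \<Longrightarrow> x 1 \<in> borel_measurable (info J)"
  by (rule measurableI) (auto intro!: gen_in_info in_vimage_algebra simp: gen_def source_events_def)

lemma sample_in_gen:
  "A \<in> sets D \<Longrightarrow> \<zeta> k i -` A \<inter> space M \<in> gen (Sample k i)"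
  by (auto intro!: in_vimage_algebra simp: gen_def source_events_def)

lemma sample_info:
  assumes "Sample k i \<in> J" "k \<in> {1..K}" "i \<in> {1..bsize k}"
  shows "\<zeta> k i \<in> measurable (info J) D"
proof (rule measurableI)
  show "\<zeta> k i \<omega> \<in> space D" if "\<omega> \<in> space (info J)" for \<omega>
    using measurable_space[OF sample_meas] assms that by (auto simp: bsize_def)
  show "\<zeta> k i -` A \<inter> space (info J) \<in> sets (info J)" if "A \<in> sets D" for A
    using gen_in_info[OF assms(1) sample_in_gen[OF that]] by simp
qed

lemma past_mono: "k \<le> k' \<Longrightarrow> past k \<subseteq> past k'"
  by (auto simp: past_def)

lemma past_sources: "k \<le> K + 1 \<Longrightarrow> past k \<subseteq> sources K bsize"
  by (auto simp: past_def sources_def)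

lemma x_in: "k \<in> {1..K + 1} \<Longrightarrow> \<omega> \<in> space M \<Longrightarrow> x k \<omega> \<in> X"
proof (induction k)
  case (Suc k)
  show ?case
  proof (cases "k = 0")
    case True
    then show ?thesis using start_in Suc by simp
  next
    case False
    then have k: "k \<in> {1..K}" and "x k \<omega> \<in> X" using Suc by auto
    then have "x (k + 1) \<omega> \<in> trust_region X \<psi> (x k \<omega>)"
      using update[OF k] Suc pos by (intro prox_step_in) auto
    then show ?thesis by (simp add: trust_region_def)
  qed
qed simp

lemma x_step_le:
  assumes "k \<in> {1..K}" "\<omega> \<in> space M"
  shows "l1norm (x (k + 1) \<omega> - x k \<omega>) \<le> \<psi>"
  using prox_step_in[OF update[OF assms]] x_in[of k \<omega>] assms pos by (auto simp: trust_region_def)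

lemma gF_meas [measurable]: "(\<lambda>p. gF (fst p) (snd p)) \<in> borel_measurable (borel \<Otimes>\<^sub>M D)"
  unfolding gF_def by (rule borel_measurable_grad_pair[OF F_meas F_diff])

lemma gF_compose:
  "U \<in> borel_measurable N \<Longrightarrow> Z \<in> measurable N D \<Longrightarrow> (\<lambda>\<omega>. gF (U \<omega>) (Z \<omega>)) \<in> borel_measurable N"
  using measurable_compose[OF measurable_Pair gF_meas, of U N Z] by simp

lemma grad_f_meas [measurable]: "grad f \<in> borel_measurable borel"
  using f_diff by (rule borel_measurable_grad)

lemma f_meas [measurable]: "f \<in> borel_measurable borel"
  using f_diff by (intro borel_measurable_continuous_onI differentiable_imp_continuous_on)
    (auto simp: differentiable_on_def)

text \<open>The previous iterate and estimate are carried in the same induction, since the recursive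
  estimate uses both.\<close>

lemma measurable_past:
  assumes "k \<in> {1..K + 1}"
  shows "x k \<in> borel_measurable (info (past k))"
    and "k \<ge> 2 \<Longrightarrow> x (k - 1) \<in> borel_measurable (info (past k))"
    and "k \<ge> 2 \<Longrightarrow> G (k - 1) \<in> borel_measurable (info (past k))"
proof -
  have "x k \<in> borel_measurable (info (past k)) \<and>
    (k \<ge> 2 \<longrightarrow> x (k - 1) \<in> borel_measurable (info (past k)) \<and> G (k - 1) \<in> borel_measurable (info (past k)))"
    using assms
  proof (induction k)
    case (Suc k)
    let ?I = "info (past (Suc k))"
    show ?case
    proof (cases "k = 0")
      case True
      then show ?thesis using start_info by (simp add: past_def)
    next
      case False
      then have k: "k \<in> {1..K}" using Suc by simp
      have IH: "x k \<in> borel_measurable ?I"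
        "k \<ge> 2 \<Longrightarrow> x (k - 1) \<in> borel_measurable ?I" "k \<ge> 2 \<Longrightarrow> G (k - 1) \<in> borel_measurable ?I"
        using Suc k past_mono[of k "Suc k"] by (auto intro: measurable_info_mono)
      have z: "\<zeta> k i \<in> measurable ?I D" if "i \<in> {1..bsize k}" for i
        using that k by (intro sample_info) (auto simp: past_def)
      have "(\<lambda>\<omega>. if [k = 1] (mod q0)
           then (1 / real (bsize k)) *\<^sub>R (\<Sum>i = 1..bsize k. gF (x k \<omega>) (\<zeta> k i \<omega>))
           else (1 / real (bsize k)) *\<^sub>R
                  (\<Sum>i = 1..bsize k. gF (x k \<omega>) (\<zeta> k i \<omega>) - gF (x (k - 1) \<omega>) (\<zeta> k i \<omega>)) + G (k - 1) \<omega>)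
         \<in> borel_measurable ?I"
      proof (cases "[k = 1] (mod q0)")
        case True
        then show ?thesis using IH z
          by (simp only: if_True) (intro borel_measurable_scaleR borel_measurable_const
              borel_measurable_sum gF_compose)
      next
        case False
        \<comment> \<open>Iteration \<open>1\<close> is always a restart, so a recursive estimate
          has genuine predecessors.\<close>
        then have "k \<noteq> 1" by auto
        then have "k \<ge> 2" using k by auto
        then show ?thesis using IH z False
          by (simp only: if_False) (intro borel_measurable_scaleR borel_measurable_const borel_measurable_add
              borel_measurable_diff borel_measurable_sum gF_compose; simp)
      qed
      then have Gk: "G k \<in> borel_measurable ?I"
        by (rule measurable_cong[THEN iffD2, rotated])
          (use k in \<open>simp add: estimate gF_def bsize_def\<close>)
      \<comment> \<open>The minimiser is unique, so the argmin relation becomes a measurable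
        function of iterate and estimate.\<close>
      have "(\<lambda>\<omega>. prox_map X \<psi> (x k \<omega>, x k \<omega> - \<eta> *\<^sub>R G k \<omega>)) \<in> borel_measurable ?I"
        using IH Gk x_in[of k] k
        by (intro borel_measurable_prox_map closed_X convex_X pos borel_measurable_diff
            borel_measurable_scaleR borel_measurable_const) auto
      then have "x (Suc k) \<in> borel_measurable ?I"
        by (rule measurable_cong[THEN iffD2, rotated])
          (use k pos update in \<open>auto intro!: prox_step_eq_prox_map closed_X convex_X x_in\<close>)
      then show ?thesis using Gk IH by simp
    qed
  qed simp
  then show "x k \<in> borel_measurable (info (past k))"
    "k \<ge> 2 \<Longrightarrow> x (k - 1) \<in> borel_measurable (info (past k))"
    "k \<ge> 2 \<Longrightarrow> G (k - 1) \<in> borel_measurable (info (past k))" by auto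
qed

lemma x_meas: "k \<in> {1..K + 1} \<Longrightarrow> x k \<in> borel_measurable M"
  using measurable_past(1) past_sources by (auto intro: measurable_info_M)

section \<open>Moments of the gradient error\<close>

lemma err_past: "k \<in> {1..K} \<Longrightarrow> err k \<in> borel_measurable (info (past (Suc k)))"
  using measurable_past(2,3)[of "Suc k"] unfolding err_def
  by (intro borel_measurable_diff measurable_compose[OF _ grad_f_meas]) auto

lemma err_meas: "k \<in> {1..K} \<Longrightarrow> err k \<in> borel_measurable M"
  using err_past past_sources[of "Suc k"] by (auto intro: measurable_info_M)

text \<open>A batch is consumed one sample at a time: sample \<open>i + 1\<close> is independent of
  the past together with the first \<open>i\<close> samples. Each of the \<open>bsize k\<close>
  steps carries the squared weight \<open>1 / bsize k ^ 2\<close>, so one factor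
  \<open>1 / bsize k\<close> survives. The pair \<open>U\<close> makes room for two iterates, as
  recursive corrections need.\<close>

lemma pot_batch:
  fixes v :: "'w \<Rightarrow> real^'n" and U :: "'w \<Rightarrow> (real^'n) \<times> (real^'n)"
    and w :: "((real^'n) \<times> (real^'n)) \<times> 'z \<Rightarrow> real^'n"
  assumes k: "k \<in> {1..K}"
    and \<delta>: "\<delta> > 0" and r: "r \<ge> 1" and card: "real CARD('n) \<le> 2 ^ (r - 1)"
    and v: "v \<in> borel_measurable (info (past k))" and U: "U \<in> borel_measurable (info (past k))"
    and w [measurable]: "w \<in> borel_measurable (borel \<Otimes>\<^sub>M D)"
    and mean: "\<And>\<omega>. \<omega> \<in> space M \<Longrightarrow> has_bochner_integral D (\<lambda>z. w (U \<omega>, z)) 0"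
    and second: "\<And>\<omega>. \<omega> \<in> space M \<Longrightarrow> integrable D (\<lambda>z. (infnorm (w (U \<omega>, z)))\<^sup>2)"
      "\<And>\<omega>. \<omega> \<in> space M \<Longrightarrow> (\<integral>z. (infnorm (w (U \<omega>, z)))\<^sup>2 \<partial>D) \<le> c"
    and c: "c \<ge> 0"
    and int: "integrable M (\<lambda>\<omega>. pot r \<delta> (v \<omega>))"
  defines "V \<equiv> \<lambda>i \<omega>. v \<omega> + (1 / real (bsize k)) *\<^sub>R (\<Sum>j = 1..i. w (U \<omega>, \<zeta> k j \<omega>))"
  shows "integrable M (\<lambda>\<omega>. pot r \<delta> (V (bsize k) \<omega>))"
    and "expectation (\<lambda>\<omega>. pot r \<delta> (V (bsize k) \<omega>))
      \<le> expectation (\<lambda>\<omega>. pot r \<delta> (v \<omega>)) + 3 * (2 * real r - 1) * (c / real (bsize k))"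
proof -
  define a where "a = 1 / real (bsize k)"
  define J where "J i = past k \<union> {Sample k j | j. j \<in> {1..i}}" for i
  have step: "V i \<in> borel_measurable (info (J i)) \<and> integrable M (\<lambda>\<omega>. pot r \<delta> (V i \<omega>)) \<and>
      expectation (\<lambda>\<omega>. pot r \<delta> (V i \<omega>))
      \<le> expectation (\<lambda>\<omega>. pot r \<delta> (v \<omega>)) + real i * (3 * (2 * real r - 1) * (a\<^sup>2 * c))"
    if "i \<le> bsize k" for i
    using that
  proof (induction i)
    case 0
    then show ?case using v int by (simp add: V_def J_def)
  next
    case (Suc i)
    then have IH: "V i \<in> borel_measurable (info (J i))" "integrable M (\<lambda>\<omega>. pot r \<delta> (V i \<omega>))"
      "expectation (\<lambda>\<omega>. pot r \<delta> (V i \<omega>))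
      \<le> expectation (\<lambda>\<omega>. pot r \<delta> (v \<omega>)) + real i * (3 * (2 * real r - 1) * (a\<^sup>2 * c))"
      by auto
    have i: "Suc i \<in> {1..bsize k}" using Suc by simp
    have VS: "V (Suc i) \<omega> = V i \<omega> + a *\<^sub>R w (U \<omega>, \<zeta> k (Suc i) \<omega>)" for \<omega>
      by (simp add: V_def a_def scaleR_add_right)
    have Jsub: "J i \<subseteq> sources K bsize" using k i past_sources[of k] by (auto simp: J_def sources_def)
    have UJ: "U \<in> borel_measurable (info (J j))" for j
      using U by (rule measurable_info_mono[rotated]) (auto simp: J_def)
    have UV: "(\<lambda>\<omega>. (U \<omega>, V i \<omega>)) \<in> info (J i) \<rightarrow>\<^sub>M borel \<Otimes>\<^sub>M borel"
      using UJ IH by (intro measurable_Pair)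
    have zM: "\<zeta> k (Suc i) \<in> M \<rightarrow>\<^sub>M D" and law: "distr M D (\<zeta> k (Suc i)) = D"
      using sample_meas sample_law k i by (auto simp: bsize_def)
    \<comment> \<open>\<open>U\<close> and the partial sum are frozen together: the increment
      depends on \<open>U\<close>, the potential on the partial sum.\<close>
    have pair: "distr M ((borel \<Otimes>\<^sub>M borel) \<Otimes>\<^sub>M D) (\<lambda>\<omega>. ((U \<omega>, V i \<omega>), \<zeta> k (Suc i) \<omega>))
        = distr M (borel \<Otimes>\<^sub>M borel) (\<lambda>\<omega>. (U \<omega>, V i \<omega>)) \<Otimes>\<^sub>M distr M D (\<zeta> k (Suc i))"
    proof (rule indep_sets_distr_pair[OF indep[folded gen_def bsize_def] gen_stable Jsub])
      show "Sample k (Suc i) \<in> sources K bsize" using k i by (auto simp: sources_def)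
      show "Sample k (Suc i) \<notin> J i" by (auto simp: J_def past_def)
      show "(\<lambda>\<omega>. (U \<omega>, V i \<omega>)) \<in> sigma (space M) (\<Union> (gen ` J i)) \<rightarrow>\<^sub>M borel \<Otimes>\<^sub>M borel"
        using UV by (simp add: info_def)
    qed (use zM sample_in_gen in auto)
    have w': "(\<lambda>p. w (fst (fst p), snd p)) \<in> borel_measurable
        (((borel :: ((real^'n) \<times> (real^'n)) measure) \<Otimes>\<^sub>M (borel :: (real^'n) measure)) \<Otimes>\<^sub>M D)"
      by measurable
    note S = pot_step[OF measurable_info_M[OF Jsub UV] zM pair[unfolded law] D.prob_space_axioms \<delta> r card
        measurable_snd w', where c = c and a = a, simplified, OF mean second c IH(2)]
    have "V (Suc i) \<in> borel_measurable (info (J (Suc i)))"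
    proof -
      have "V i \<in> borel_measurable (info (J (Suc i)))"
        using IH(1) by (rule measurable_info_mono[rotated]) (auto simp: J_def)
      moreover have "\<zeta> k (Suc i) \<in> info (J (Suc i)) \<rightarrow>\<^sub>M D"
        using k i by (intro sample_info) (auto simp: J_def)
      ultimately show ?thesis unfolding VS[abs_def] using UJ[of "Suc i"] by measurable
    qed
    moreover have "integrable M (\<lambda>\<omega>. pot r \<delta> (V (Suc i) \<omega>))" using S(1) by (simp add: VS)
    moreover have "expectation (\<lambda>\<omega>. pot r \<delta> (V (Suc i) \<omega>))
      \<le> expectation (\<lambda>\<omega>. pot r \<delta> (v \<omega>)) + real (Suc i) * (3 * (2 * real r - 1) * (a\<^sup>2 * c))"
      using S(2) IH(3) by (simp add: VS algebra_simps)
    ultimately show ?case by blast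
  qed
  show "integrable M (\<lambda>\<omega>. pot r \<delta> (V (bsize k) \<omega>))" using step[of "bsize k"] by simp
  have "real (bsize k) * (3 * (2 * real r - 1) * (a\<^sup>2 * c)) = 3 * (2 * real r - 1) * (c / real (bsize k))"
    using bsize_pos[of k] by (simp add: a_def power2_eq_square)
  then show "expectation (\<lambda>\<omega>. pot r \<delta> (V (bsize k) \<omega>))
      \<le> expectation (\<lambda>\<omega>. pot r \<delta> (v \<omega>)) + 3 * (2 * real r - 1) * (c / real (bsize k))"
    using step[of "bsize k"] by simp
qed

lemma const_integral: "has_bochner_integral D (\<lambda>_. c :: real^'n) c"
  by (simp add: has_bochner_integral_iff D.prob_space)

lemma gF_integral: "y \<in> X \<Longrightarrow> has_bochner_integral D (gF y) (grad f y)"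
  using unbiased by (simp add: gF_def[abs_def])

text \<open>Unbiasedness and Jensen transfer the mean-square Lipschitz bound from the samples to
  \<open>f\<close>.\<close>

lemma grad_f_lipschitz_sq:
  assumes "y \<in> X" "y' \<in> X"
  shows "(infnorm (grad f y - grad f y'))\<^sup>2 \<le> L\<^sup>2 * (l1norm (y - y'))\<^sup>2"
proof -
  have hb: "has_bochner_integral D (\<lambda>z. gF y z - gF y' z) (grad f y - grad f y')"
    using assms by (intro has_bochner_integral_diff gF_integral)
  then have "(infnorm (grad f y - grad f y'))\<^sup>2 \<le> (\<integral>z. (infnorm (gF y z - gF y' z))\<^sup>2 \<partial>D)"
    using D.infnorm_expectation_sq_le[of "\<lambda>z. gF y z - gF y' z"] mean_lipschitz[OF assms]
    by (simp add: has_bochner_integral_iff gF_def)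
  also have "\<dots> \<le> L\<^sup>2 * (l1norm (y - y'))\<^sup>2" using mean_lipschitz[OF assms] by (simp add: gF_def)
  finally show ?thesis .
qed

lemma grad_f_lipschitz:
  assumes "y \<in> X" "y' \<in> X"
  shows "infnorm (grad f y - grad f y') \<le> L * l1norm (y - y')"
proof (rule power2_le_imp_le)
  show "(infnorm (grad f y - grad f y'))\<^sup>2 \<le> (L * l1norm (y - y'))\<^sup>2"
    using grad_f_lipschitz_sq[OF assms] by (simp add: power_mult_distrib)
  show "0 \<le> L * l1norm (y - y')" using L by (simp add: l1norm_nonneg)
qed

text \<open>In the max-norm, centring may increase the second moment. The bound
  \<open>(a + b)^2 \<le> 2 * a^2 + 2 * b^2\<close> pays for it, with sample and mean contributing
  \<open>2 * L^2 * \<psi>^2\<close> each; this is the origin of the \<open>4\<close> under the root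
  in the theorem.\<close>

lemma gF_diff_variance:
  assumes y: "y \<in> X" "y' \<in> X" and le: "l1norm (y - y') \<le> \<psi>"
  defines "w \<equiv> \<lambda>z. gF y z - gF y' z - (grad f y - grad f y')"
  shows "integrable D (\<lambda>z. (infnorm (w z))\<^sup>2)"
    and "(\<integral>z. (infnorm (w z))\<^sup>2 \<partial>D) \<le> 4 * L\<^sup>2 * \<psi>\<^sup>2"
proof -
  define g where "g z = gF y z - gF y' z" for z
  define h where "h = grad f y - grad f y'"
  have g: "has_bochner_integral D g h"
    unfolding g_def h_def using y by (intro has_bochner_integral_diff gF_integral)
  then have [measurable]: "g \<in> borel_measurable D" by (auto simp: has_bochner_integral_iff)
  have g2: "integrable D (\<lambda>z. (infnorm (g z))\<^sup>2)" "(\<integral>z. (infnorm (g z))\<^sup>2 \<partial>D) \<le> L\<^sup>2 * (l1norm (y - y'))\<^sup>2"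
    using mean_lipschitz[OF y] by (auto simp: g_def gF_def)
  have sq: "(infnorm (w z))\<^sup>2 \<le> 2 * (infnorm (g z))\<^sup>2 + 2 * (infnorm h)\<^sup>2" for z
  proof -
    have "w z = g z + - h" by (simp add: w_def g_def h_def)
    then have "infnorm (w z) \<le> infnorm (g z) + infnorm h"
      using infnorm_triangle[of "g z" "- h"] by (simp only: infnorm_neg)
    then have "(infnorm (w z))\<^sup>2 \<le> (infnorm (g z) + infnorm h)\<^sup>2" by (intro power_mono infnorm_pos_le)
    also have "\<dots> \<le> 2 * (infnorm (g z))\<^sup>2 + 2 * (infnorm h)\<^sup>2"
      using sum_squares_bound[of "infnorm (g z)" "infnorm h"] by (simp add: power2_sum)
    finally show ?thesis .
  qed
  have B: "integrable D (\<lambda>z. 2 * (infnorm (g z))\<^sup>2 + 2 * (infnorm h)\<^sup>2)"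
    by (intro Bochner_Integration.integrable_add integrable_mult_right g2 D.integrable_const)
  have w_eq: "w z = g z - h" for z by (simp add: w_def g_def h_def)
  show wint: "integrable D (\<lambda>z. (infnorm (w z))\<^sup>2)"
    by (rule Bochner_Integration.integrable_bound[OF B]) (use sq in \<open>auto simp: w_eq\<close>)
  have lq: "L\<^sup>2 * (l1norm (y - y'))\<^sup>2 \<le> L\<^sup>2 * \<psi>\<^sup>2"
    using le by (intro mult_left_mono power_mono l1norm_nonneg) auto
  have "(\<integral>z. (infnorm (w z))\<^sup>2 \<partial>D) \<le> (\<integral>z. 2 * (infnorm (g z))\<^sup>2 + 2 * (infnorm h)\<^sup>2 \<partial>D)"
    by (intro integral_mono wint B sq)
  also have "\<dots> = 2 * (\<integral>z. (infnorm (g z))\<^sup>2 \<partial>D) + 2 * (infnorm h)\<^sup>2"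
    using g2 by (simp add: D.prob_space)
  also have "\<dots> \<le> 2 * (L\<^sup>2 * \<psi>\<^sup>2) + 2 * (L\<^sup>2 * \<psi>\<^sup>2)"
    using g2(2) grad_f_lipschitz_sq[OF y] lq unfolding h_def by (intro add_mono mult_left_mono) linarith+
  finally show "(\<integral>z. (infnorm (w z))\<^sup>2 \<partial>D) \<le> 4 * L\<^sup>2 * \<psi>\<^sup>2" by simp
qed

text \<open>\<open>(k - 1) mod q0\<close> counts the corrections since the last restart. A restart
  forgets the earlier error and starts the potential from
  \<open>pot r \<delta> 0 = \<delta>\<close>; every correction adds at most
  \<open>4 * L^2 * \<psi>^2 / m\<close> times the curvature constant.\<close>

lemma pot_err:
  assumes \<delta>: "\<delta> > 0" and r: "r \<ge> 1" and card: "real CARD('n) \<le> 2 ^ (r - 1)"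
    and k: "k \<in> {1..K}"
  shows "integrable M (\<lambda>\<omega>. pot r \<delta> (err k \<omega>)) \<and>
    expectation (\<lambda>\<omega>. pot r \<delta> (err k \<omega>)) \<le> \<delta> + 3 * (2 * real r - 1) *
      (\<sigma>sq / real m1 + real ((k - 1) mod q0) * (4 * L\<^sup>2 * \<psi>\<^sup>2 / real m))"
  using k
proof (induction k rule: less_induct)
  case (less k)
  have k: "k \<in> {1..K}" by fact
  have xk: "x k \<in> borel_measurable (info (past k))" using measurable_past(1) k by simp
  have C: "0 \<le> 3 * (2 * real r - 1)" using r by simp
  show ?case
  proof (cases "[k = 1] (mod q0)")
    case True
    have mod0: "(k - 1) mod q0 = 0"
      using True k by (simp add: cong_altdef_nat mod_eq_0_iff_dvd)
    have bk: "bsize k = m1" using True by (simp add: bsize_def batch_def)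
    define w where "w p = gF (fst (fst p)) (snd p) - grad f (fst (fst p))"
      for p :: "((real^'n) \<times> (real^'n)) \<times> 'z"
    have w: "w \<in> borel_measurable (borel \<Otimes>\<^sub>M D)"
    proof -
      have "fst \<circ> fst \<in> borel_measurable ((borel :: ((real^'n) \<times> (real^'n)) measure) \<Otimes>\<^sub>M D)"
        unfolding borel_prod[symmetric] by (simp add: comp_def)
      then show ?thesis unfolding w_def comp_def
        by (intro borel_measurable_diff gF_compose measurable_compose[OF _ grad_f_meas]) auto
    qed
    have eq: "err k \<omega> = 0 + (1 / real (bsize k)) *\<^sub>R (\<Sum>j = 1..bsize k. w ((x k \<omega>, x k \<omega>), \<zeta> k j \<omega>))"
      if "\<omega> \<in> space M" for \<omega>
      using estimate[OF k that] True bsize_pos[of k]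
      by (simp add: err_def w_def gF_def bsize_def[symmetric] sum_subtractf scaleR_diff_right
          sum_constant_scaleR del: sum_constant)
    have U: "(\<lambda>\<omega>. (x k \<omega>, x k \<omega>)) \<in> borel_measurable (info (past k))"
      using xk by (intro borel_measurable_Pair)
    have moments: "has_bochner_integral D (\<lambda>z. w ((x k \<omega>, x k \<omega>), z)) 0"
      "integrable D (\<lambda>z. (infnorm (w ((x k \<omega>, x k \<omega>), z)))\<^sup>2)"
      "(\<integral>z. (infnorm (w ((x k \<omega>, x k \<omega>), z)))\<^sup>2 \<partial>D) \<le> \<sigma>sq"
      if \<omega>: "\<omega> \<in> space M" for \<omega>
    proof -
      have X: "x k \<omega> \<in> X" using x_in k \<omega> by simp
      show "has_bochner_integral D (\<lambda>z. w ((x k \<omega>, x k \<omega>), z)) 0"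
        using has_bochner_integral_diff[OF gF_integral[OF X] const_integral[of "grad f (x k \<omega>)"]]
        by (simp add: w_def)
      show "integrable D (\<lambda>z. (infnorm (w ((x k \<omega>, x k \<omega>), z)))\<^sup>2)"
        "(\<integral>z. (infnorm (w ((x k \<omega>, x k \<omega>), z)))\<^sup>2 \<partial>D) \<le> \<sigma>sq"
        using var_integrable[OF X] var_le[OF X] by (auto simp: w_def gF_def)
    qed
    have "integrable M (\<lambda>\<omega>. pot r \<delta> (0 + (1 / real (bsize k)) *\<^sub>R (\<Sum>j = 1..bsize k. w ((x k \<omega>, x k \<omega>), \<zeta> k j \<omega>)))) \<and>
      expectation (\<lambda>\<omega>. pot r \<delta> (0 + (1 / real (bsize k)) *\<^sub>R (\<Sum>j = 1..bsize k. w ((x k \<omega>, x k \<omega>), \<zeta> k j \<omega>))))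
        \<le> expectation (\<lambda>\<omega>. pot r \<delta> (0 :: real^'n)) + 3 * (2 * real r - 1) * (\<sigma>sq / real (bsize k))"
      by (intro conjI pot_batch[OF k \<delta> r card borel_measurable_const U w moments \<sigma>sq] integrable_const)
    moreover have "integrable M (\<lambda>\<omega>. pot r \<delta> (err k \<omega>)) \<longleftrightarrow>
        integrable M (\<lambda>\<omega>. pot r \<delta> (0 + (1 / real (bsize k)) *\<^sub>R (\<Sum>j = 1..bsize k. w ((x k \<omega>, x k \<omega>), \<zeta> k j \<omega>))))"
      by (intro Bochner_Integration.integrable_cong refl) (simp only: eq)
    moreover have "expectation (\<lambda>\<omega>. pot r \<delta> (err k \<omega>)) =
        expectation (\<lambda>\<omega>. pot r \<delta> (0 + (1 / real (bsize k)) *\<^sub>R (\<Sum>j = 1..bsize k. w ((x k \<omega>, x k \<omega>), \<zeta> k j \<omega>))))"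
      by (intro Bochner_Integration.integral_cong refl) (simp only: eq)
    ultimately show ?thesis
      using mod0 bk by (simp add: pot_zero[OF \<delta> r] prob_space)
  next
    case False
    then have "k \<noteq> 1" by auto
    then have k2: "k \<ge> 2" using k by auto
    define k' where "k' = k - 1"
    have k': "k' \<in> {1..K}" "k' < k" "k = Suc k'" using k k2 by (auto simp: k'_def)
    \<comment> \<open>Away from a restart the residue does not wrap around.\<close>
    have md: "(k - 1) mod q0 = Suc ((k' - 1) mod q0)"
    proof -
      have "\<not> q0 dvd (k - 1)" using False k by (simp add: cong_altdef_nat)
      then have "Suc (k' - 1) mod q0 \<noteq> 0" using k' by (simp add: mod_eq_0_iff_dvd)
      then show ?thesis using k' mod_Suc[of "k' - 1" q0] by (auto split: if_splits)
    qed
    have bk: "bsize k = m" using False by (simp add: bsize_def batch_def)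
    have IH: "integrable M (\<lambda>\<omega>. pot r \<delta> (err k' \<omega>))"
      "expectation (\<lambda>\<omega>. pot r \<delta> (err k' \<omega>)) \<le> \<delta> + 3 * (2 * real r - 1) *
      (\<sigma>sq / real m1 + real ((k' - 1) mod q0) * (4 * L\<^sup>2 * \<psi>\<^sup>2 / real m))"
      using less.IH[OF k'(2,1)] by auto
    define w where "w p = gF (fst (fst p)) (snd p) - gF (snd (fst p)) (snd p)
        - (grad f (fst (fst p)) - grad f (snd (fst p)))"
      for p :: "((real^'n) \<times> (real^'n)) \<times> 'z"
    have w: "w \<in> borel_measurable (borel \<Otimes>\<^sub>M D)"
    proof -
      have "fst \<circ> fst \<in> borel_measurable ((borel :: ((real^'n) \<times> (real^'n)) measure) \<Otimes>\<^sub>M D)"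
        "snd \<circ> fst \<in> borel_measurable ((borel :: ((real^'n) \<times> (real^'n)) measure) \<Otimes>\<^sub>M D)"
        unfolding borel_prod[symmetric] by (simp_all add: comp_def)
      then show ?thesis unfolding w_def comp_def
        by (intro borel_measurable_diff gF_compose measurable_compose[OF _ grad_f_meas]) auto
    qed
    \<comment> \<open>The martingale recursion: a correction changes the error by an average of
      centred gradient differences.\<close>
    have eq: "err k \<omega> = err k' \<omega> + (1 / real (bsize k)) *\<^sub>R (\<Sum>j = 1..bsize k. w ((x k \<omega>, x k' \<omega>), \<zeta> k j \<omega>))"
      if "\<omega> \<in> space M" for \<omega>
    proof -
      have "(\<Sum>j = 1..bsize k. w ((x k \<omega>, x k' \<omega>), \<zeta> k j \<omega>))
          = (\<Sum>j = 1..bsize k. gF (x k \<omega>) (\<zeta> k j \<omega>) - gF (x k' \<omega>) (\<zeta> k j \<omega>))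
            - real (bsize k) *\<^sub>R (grad f (x k \<omega>) - grad f (x k' \<omega>))"
        by (simp add: w_def sum_subtractf scaleR_diff_right sum_constant_scaleR del: sum_constant)
      then have "(1 / real (bsize k)) *\<^sub>R (\<Sum>j = 1..bsize k. w ((x k \<omega>, x k' \<omega>), \<zeta> k j \<omega>))
          = (1 / real (bsize k)) *\<^sub>R (\<Sum>j = 1..bsize k. gF (x k \<omega>) (\<zeta> k j \<omega>) - gF (x k' \<omega>) (\<zeta> k j \<omega>))
            - (grad f (x k \<omega>) - grad f (x k' \<omega>))"
        using bsize_pos[of k] by (simp only: scaleR_diff_right[of "1 / real (bsize k)"]) simp
      then show ?thesis
        using estimate[OF k that] False k'(3)
        by (simp add: err_def gF_def bsize_def[symmetric])
    qed
    have U: "(\<lambda>\<omega>. (x k \<omega>, x k' \<omega>)) \<in> borel_measurable (info (past k))"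
      using xk measurable_past(2)[of k] k k2 by (intro borel_measurable_Pair) (auto simp: k'_def)
    have v: "err k' \<in> borel_measurable (info (past k))" using err_past[OF k'(1)] k' by simp
    have moments: "has_bochner_integral D (\<lambda>z. w ((x k \<omega>, x k' \<omega>), z)) 0"
      "integrable D (\<lambda>z. (infnorm (w ((x k \<omega>, x k' \<omega>), z)))\<^sup>2)"
      "(\<integral>z. (infnorm (w ((x k \<omega>, x k' \<omega>), z)))\<^sup>2 \<partial>D) \<le> 4 * L\<^sup>2 * \<psi>\<^sup>2"
      if \<omega>: "\<omega> \<in> space M" for \<omega>
    proof -
      have X: "x k \<omega> \<in> X" "x k' \<omega> \<in> X" using x_in k k' \<omega> by auto
      have le: "l1norm (x k \<omega> - x k' \<omega>) \<le> \<psi>" using x_step_le[OF k'(1) \<omega>] k' by simp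
      show "has_bochner_integral D (\<lambda>z. w ((x k \<omega>, x k' \<omega>), z)) 0"
        using has_bochner_integral_diff[OF has_bochner_integral_diff[OF gF_integral[OF X(1)] gF_integral[OF X(2)]]
            const_integral[of "grad f (x k \<omega>) - grad f (x k' \<omega>)"]]
        by (simp add: w_def)
      show "integrable D (\<lambda>z. (infnorm (w ((x k \<omega>, x k' \<omega>), z)))\<^sup>2)"
        "(\<integral>z. (infnorm (w ((x k \<omega>, x k' \<omega>), z)))\<^sup>2 \<partial>D) \<le> 4 * L\<^sup>2 * \<psi>\<^sup>2"
        using gF_diff_variance[OF X le] by (auto simp: w_def)
    qed
    have "integrable M (\<lambda>\<omega>. pot r \<delta> (err k' \<omega> + (1 / real (bsize k)) *\<^sub>R (\<Sum>j = 1..bsize k. w ((x k \<omega>, x k' \<omega>), \<zeta> k j \<omega>)))) \<and>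
      expectation (\<lambda>\<omega>. pot r \<delta> (err k' \<omega> + (1 / real (bsize k)) *\<^sub>R (\<Sum>j = 1..bsize k. w ((x k \<omega>, x k' \<omega>), \<zeta> k j \<omega>))))
        \<le> expectation (\<lambda>\<omega>. pot r \<delta> (err k' \<omega>)) + 3 * (2 * real r - 1) * (4 * L\<^sup>2 * \<psi>\<^sup>2 / real (bsize k))"
      by (intro conjI pot_batch[OF k \<delta> r card v U w moments _ IH(1)]) auto
    moreover have "integrable M (\<lambda>\<omega>. pot r \<delta> (err k \<omega>)) \<longleftrightarrow>
        integrable M (\<lambda>\<omega>. pot r \<delta> (err k' \<omega> + (1 / real (bsize k)) *\<^sub>R (\<Sum>j = 1..bsize k. w ((x k \<omega>, x k' \<omega>), \<zeta> k j \<omega>))))"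
      by (intro Bochner_Integration.integrable_cong refl) (simp only: eq)
    moreover have "expectation (\<lambda>\<omega>. pot r \<delta> (err k \<omega>)) =
        expectation (\<lambda>\<omega>. pot r \<delta> (err k' \<omega> + (1 / real (bsize k)) *\<^sub>R (\<Sum>j = 1..bsize k. w ((x k \<omega>, x k' \<omega>), \<zeta> k j \<omega>))))"
      by (intro Bochner_Integration.integral_cong refl) (simp only: eq)
    moreover have "\<delta> + C * (A + n * q) + C * q = \<delta> + C * (A + (1 + n) * q)" for C A n q :: real
      by (simp add: algebra_simps)
    note this[of "3 * (2 * real r - 1)" "\<sigma>sq / real m1" "real ((k' - 1) mod q0)" "4 * L\<^sup>2 * \<psi>\<^sup>2 / real m"]
    ultimately show ?thesis
      using IH(2) unfolding bk md of_nat_Suc by linarith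
  qed
qed

lemma err_second_moment:
  assumes dim: "CARD('n) \<ge> 2" and k: "k \<in> {1..K}"
  defines "\<Omega> \<equiv> (exp 1)\<^sup>2 * ln (real CARD('n))"
  shows "integrable M (\<lambda>\<omega>. (infnorm (err k \<omega>))\<^sup>2)"
    and "expectation (\<lambda>\<omega>. (infnorm (err k \<omega>))\<^sup>2)
      \<le> \<Omega>\<^sup>2 * \<sigma>sq / real m1 + 4 * \<Omega>\<^sup>2 * L\<^sup>2 * real q0 / real m * \<psi>\<^sup>2"
proof -
  note [measurable] = err_meas[OF k]
  obtain r where r: "r \<ge> 1" "real CARD('n) \<le> 2 ^ (r - 1)" "3 * (2 * real r - 1) \<le> \<Omega>\<^sup>2"
    using log_dimension_bound[OF dim] unfolding \<Omega>_def by metis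
  have P: "integrable M (\<lambda>\<omega>. pot r \<delta> (err k \<omega>))"
    "expectation (\<lambda>\<omega>. pot r \<delta> (err k \<omega>)) \<le> \<delta> + 3 * (2 * real r - 1) *
      (\<sigma>sq / real m1 + real ((k - 1) mod q0) * (4 * L\<^sup>2 * \<psi>\<^sup>2 / real m))" if "\<delta> > 0" for \<delta>
    using pot_err[OF that r(1,2) k] by auto
  show int: "integrable M (\<lambda>\<omega>. (infnorm (err k \<omega>))\<^sup>2)"
  proof (rule Bochner_Integration.integrable_bound[OF P(1)[of 1]])
    have "norm ((infnorm (err k \<omega>))\<^sup>2) \<le> norm (pot r 1 (err k \<omega>))" for \<omega>
      using infnorm_sq_le_pot[of 1 r "err k \<omega>"] r(1) by simp
    then show "AE \<omega> in M. norm ((infnorm (err k \<omega>))\<^sup>2) \<le> norm (pot r 1 (err k \<omega>))" by simp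
  qed (simp, measurable)
  have "expectation (\<lambda>\<omega>. (infnorm (err k \<omega>))\<^sup>2) \<le> 3 * (2 * real r - 1) *
      (\<sigma>sq / real m1 + real ((k - 1) mod q0) * (4 * L\<^sup>2 * \<psi>\<^sup>2 / real m))"
  \<comment> \<open>The bound holds for every positive shift, so \<delta> can now be
    removed.\<close>
  proof (rule field_le_epsilon)
    fix \<delta> :: real assume \<delta>: "\<delta> > 0"
    have "expectation (\<lambda>\<omega>. (infnorm (err k \<omega>))\<^sup>2) \<le> expectation (\<lambda>\<omega>. pot r \<delta> (err k \<omega>))"
      by (intro integral_mono int P(1) \<delta> infnorm_sq_le_pot r(1))
    then show "expectation (\<lambda>\<omega>. (infnorm (err k \<omega>))\<^sup>2) \<le> 3 * (2 * real r - 1) *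
      (\<sigma>sq / real m1 + real ((k - 1) mod q0) * (4 * L\<^sup>2 * \<psi>\<^sup>2 / real m)) + \<delta>"
      using P(2)[OF \<delta>] by simp
  qed
  \<comment> \<open>The number of corrections since the restart is replaced by its upper bound
    \<open>q0\<close>, and the curvature constant by the square of \<Omega>.\<close>
  also have "\<dots> \<le> \<Omega>\<^sup>2 * (\<sigma>sq / real m1 + real q0 * (4 * L\<^sup>2 * \<psi>\<^sup>2 / real m))"
    using r pos \<sigma>sq by (intro mult_mono add_left_mono mult_right_mono) (auto simp: less_imp_le)
  finally show "expectation (\<lambda>\<omega>. (infnorm (err k \<omega>))\<^sup>2)
      \<le> \<Omega>\<^sup>2 * \<sigma>sq / real m1 + 4 * \<Omega>\<^sup>2 * L\<^sup>2 * real q0 / real m * \<psi>\<^sup>2"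
    by (simp add: algebra_simps)
qed

section \<open>Expected stationarity and the random output index\<close>

definition station :: "nat \<Rightarrow> 'w \<Rightarrow> real" where
  "station k \<omega> = dist0_infnorm (frechet_subdiff (\<lambda>y. ereal (f y) + delta X y) (x (k + 1) \<omega>))"

definition gap :: "nat \<Rightarrow> 'w \<Rightarrow> real" where
  "gap k \<omega> = f (x k \<omega>) - f (x (k + 1) \<omega>) + L / 2 * \<psi>\<^sup>2 + infnorm (err k \<omega>) * \<psi>"

lemma station_gap:
  assumes k: "k \<in> {1..K}" and \<omega>: "\<omega> \<in> space M"
  shows "0 \<le> gap k \<omega>"
    and "station k \<omega> \<le> L * \<psi> + \<psi> / \<eta> + infnorm (err k \<omega>) + gap k \<omega> / \<psi>"
    and "0 \<le> station k \<omega>"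
proof -
  have X: "x k \<omega> \<in> X" "x (k + 1) \<omega> \<in> X" using x_in k \<omega> by auto
  show "0 \<le> gap k \<omega>"
    unfolding gap_def err_def
    by (rule prox_step_gap_nonneg[OF closed_X convex_X X(1) pos(4,5) L f_diff grad_f_lipschitz update[OF k \<omega>]])
  show "station k \<omega> \<le> L * \<psi> + \<psi> / \<eta> + infnorm (err k \<omega>) + gap k \<omega> / \<psi>"
    unfolding gap_def err_def station_def
    by (rule prox_step_dist_le[OF closed_X convex_X X(1) pos(4,5) L f_diff grad_f_lipschitz update[OF k \<omega>]])
  show "0 \<le> station k \<omega>"
    unfolding station_def frechet_subdiff_add_delta[OF convex_X X(2) f_diff]
    using zero_in_normals by (intro dist0_infnorm_nonneg) auto
qed

text \<open>Measurability with respect to the past, not just \<open>M\<close>, is what yields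
  independence from \<open>Y\<close>.\<close>

lemma station_info:
  assumes k: "k \<in> {1..K}"
  shows "station k \<in> borel_measurable (info (past (K + 1)))"
proof -
  have "x (k + 1) \<in> borel_measurable (info (past (K + 1)))"
    using measurable_past(1)[of "k + 1"] past_mono[of "k + 1" "K + 1"] k
    by (auto intro: measurable_info_mono)
  then have "(\<lambda>\<omega>. dist0_infnorm ((+) (grad f (x (k + 1) \<omega>)) ` normals X (x (k + 1) \<omega>)))
      \<in> borel_measurable (info (past (K + 1)))"
    using k x_in
    by (intro borel_measurable_dist0_normals closed_X measurable_compose[OF _ grad_f_meas]) auto
  then show ?thesis
    by (rule measurable_cong[THEN iffD2, rotated])
      (use k x_in in \<open>simp add: station_def frechet_subdiff_add_delta[OF convex_X _ f_diff]\<close>)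
qed

lemma station_meas: "k \<in> {1..K} \<Longrightarrow> station k \<in> borel_measurable M"
  using station_info past_sources[of "K + 1"] by (auto intro: measurable_info_M)

lemma err_first_moment:
  assumes dim: "CARD('n) \<ge> 2" and k: "k \<in> {1..K}"
  shows "integrable M (\<lambda>\<omega>. infnorm (err k \<omega>))"
    and "(expectation (\<lambda>\<omega>. infnorm (err k \<omega>)))\<^sup>2 \<le> expectation (\<lambda>\<omega>. (infnorm (err k \<omega>))\<^sup>2)"
proof -
  note [measurable] = err_meas[OF k]
  show int: "integrable M (\<lambda>\<omega>. infnorm (err k \<omega>))"
    by (rule square_integrable_imp_integrable[OF _ err_second_moment(1)[OF dim k]]) measurable
  show "(expectation (\<lambda>\<omega>. infnorm (err k \<omega>)))\<^sup>2 \<le> expectation (\<lambda>\<omega>. (infnorm (err k \<omega>))\<^sup>2)"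
    using variance_eq[OF int err_second_moment(1)[OF dim k]] variance_positive[of "\<lambda>\<omega>. infnorm (err k \<omega>)"]
    by simp
qed

text \<open>Integrability is assumed at the start only. Nonnegativity of \<open>gap\<close> bounds
  the next value above by an integrable function, and \<open>flow\<close> bounds it below.\<close>

lemma f_integrable:
  assumes dim: "CARD('n) \<ge> 2" and lower: "\<And>y. y \<in> X \<Longrightarrow> flow \<le> f y"
    and start: "integrable M (\<lambda>\<omega>. f (x 1 \<omega>))"
  shows "k \<in> {1..K + 1} \<Longrightarrow> integrable M (\<lambda>\<omega>. f (x k \<omega>))"
proof (induction k)
  case (Suc k)
  show ?case
  proof (cases "k = 0")
    case True
    then show ?thesis using start by simp
  next
    case False
    then have k: "k \<in> {1..K}" using Suc by simp
    have IH: "integrable M (\<lambda>\<omega>. f (x k \<omega>))" using Suc k by simp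
    have [measurable]: "x (Suc k) \<in> borel_measurable M" using x_meas Suc by simp
    define B where "B \<omega> = f (x k \<omega>) + L / 2 * \<psi>\<^sup>2 + infnorm (err k \<omega>) * \<psi>" for \<omega>
    have B: "integrable M B"
      unfolding B_def using IH err_first_moment(1)[OF dim k] by simp
    show ?thesis
    proof (rule Bochner_Integration.integrable_bound)
      show "integrable M (\<lambda>\<omega>. \<bar>B \<omega>\<bar> + \<bar>flow\<bar>)" using B by simp
      show "AE \<omega> in M. norm (f (x (Suc k) \<omega>)) \<le> norm (\<bar>B \<omega>\<bar> + \<bar>flow\<bar>)"
      proof (intro AE_I2)
        fix \<omega> assume \<omega>: "\<omega> \<in> space M"
        have "flow \<le> f (x (Suc k) \<omega>)" using x_in Suc \<omega> by (intro lower) auto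
        moreover have "f (x (Suc k) \<omega>) \<le> B \<omega>"
          using station_gap(1)[OF k \<omega>] by (simp add: gap_def B_def)
        ultimately show "norm (f (x (Suc k) \<omega>)) \<le> norm (\<bar>B \<omega>\<bar> + \<bar>flow\<bar>)" by simp
      qed
    qed measurable
  qed
qed simp

text \<open>The error enters twice: on its own, giving \<open>sqrt S\<close>, and times \<psi>
  inside \<open>gap\<close>, where a weighted Young inequality separates the two factors.\<close>

lemma station_expectation:
  assumes dim: "CARD('n) \<ge> 2" and lower: "\<And>y. y \<in> X \<Longrightarrow> flow \<le> f y"
    and start: "integrable M (\<lambda>\<omega>. f (x 1 \<omega>))" and t: "t > 0" and k: "k \<in> {1..K}"
    and S: "expectation (\<lambda>\<omega>. (infnorm (err k \<omega>))\<^sup>2) \<le> S"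
  shows "integrable M (station k)"
    and "expectation (station k) \<le> L * \<psi> + \<psi> / \<eta> + sqrt S
      + (expectation (\<lambda>\<omega>. f (x k \<omega>)) - expectation (\<lambda>\<omega>. f (x (k + 1) \<omega>))
         + (L / 2 + 1 / (2 * t)) * \<psi>\<^sup>2 + t * S / 2) / \<psi>"
proof -
  have fk: "integrable M (\<lambda>\<omega>. f (x k \<omega>))" "integrable M (\<lambda>\<omega>. f (x (k + 1) \<omega>))"
    using f_integrable[OF dim lower start] k by auto
  note e = err_first_moment[OF dim k]
  have gap: "integrable M (gap k)" unfolding gap_def using fk e by simp
  define B where "B \<omega> = L * \<psi> + \<psi> / \<eta> + infnorm (err k \<omega>) + gap k \<omega> / \<psi>" for \<omega>
  have B: "integrable M B" unfolding B_def using e gap by simp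
  show int: "integrable M (station k)"
  proof (rule Bochner_Integration.integrable_bound[OF B station_meas[OF k]])
    show "AE \<omega> in M. norm (station k \<omega>) \<le> norm (B \<omega>)"
    proof (rule AE_I2)
      fix \<omega> assume "\<omega> \<in> space M"
      from station_gap(2,3)[OF k this] show "norm (station k \<omega>) \<le> norm (B \<omega>)" by (simp add: B_def)
    qed
  qed
  define s where "s = expectation (\<lambda>\<omega>. infnorm (err k \<omega>))"
  have sS: "s\<^sup>2 \<le> S" using e(2) S by (simp add: s_def)
  have s: "s \<le> sqrt S" using sS by (rule real_le_rsqrt)
  \<comment> \<open>Origin of \<open>t\<close>: it balances the error against the radius.
    Multiplying by \<open>2 * t\<close> reduces the claim to
    \<open>2 * a * b \<le> a^2 + b^2\<close> with \<open>a = t * s\<close> and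
    \<open>b = \<psi>\<close>.\<close>
  have young: "s * \<psi> \<le> t * S / 2 + 1 / (2 * t) * \<psi>\<^sup>2"
  proof -
    have "2 * (t * s) * \<psi> \<le> (t * s)\<^sup>2 + \<psi>\<^sup>2" by (rule sum_squares_bound)
    also have "\<dots> \<le> t\<^sup>2 * S + \<psi>\<^sup>2" using sS by (simp add: power_mult_distrib mult_left_mono)
    finally have "2 * t * (s * \<psi>) \<le> 2 * t * (t * S / 2 + 1 / (2 * t) * \<psi>\<^sup>2)"
      using t by (simp add: power2_eq_square algebra_simps)
    then show ?thesis using t by simp
  qed
  have "expectation (station k) \<le> expectation B"
    using int B station_gap(2)[OF k] by (intro integral_mono_AE) (auto simp: B_def)
  also have "expectation B = L * \<psi> + \<psi> / \<eta> + s
      + (expectation (\<lambda>\<omega>. f (x k \<omega>)) - expectation (\<lambda>\<omega>. f (x (k + 1) \<omega>)) + L / 2 * \<psi>\<^sup>2 + s * \<psi>) / \<psi>"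
    using fk e gap unfolding B_def s_def by (simp add: prob_space) (simp add: gap_def[abs_def] prob_space)
  also have "\<dots> \<le> L * \<psi> + \<psi> / \<eta> + sqrt S
      + (expectation (\<lambda>\<omega>. f (x k \<omega>)) - expectation (\<lambda>\<omega>. f (x (k + 1) \<omega>))
         + (L / 2 + 1 / (2 * t)) * \<psi>\<^sup>2 + t * S / 2) / \<psi>"
  proof (rule add_mono[OF add_left_mono[OF s] divide_right_mono])
    show "expectation (\<lambda>\<omega>. f (x k \<omega>)) - expectation (\<lambda>\<omega>. f (x (k + 1) \<omega>)) + L / 2 * \<psi>\<^sup>2 + s * \<psi>
      \<le> expectation (\<lambda>\<omega>. f (x k \<omega>)) - expectation (\<lambda>\<omega>. f (x (k + 1) \<omega>))
         + (L / 2 + 1 / (2 * t)) * \<psi>\<^sup>2 + t * S / 2"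
      using young unfolding distrib_right by linarith
    show "0 \<le> \<psi>" using pos by simp
  qed
  finally show "expectation (station k) \<le> L * \<psi> + \<psi> / \<eta> + sqrt S
      + (expectation (\<lambda>\<omega>. f (x k \<omega>)) - expectation (\<lambda>\<omega>. f (x (k + 1) \<omega>))
         + (L / 2 + 1 / (2 * t)) * \<psi>\<^sup>2 + t * S / 2) / \<psi>" .
qed

text \<open>The randomly indexed quantity is split over the values of \<open>Y\<close>; by
  independence each indicator contributes its probability \<open>1 / K\<close>.\<close>

lemma station_random_index:
  assumes Y_law: "\<And>k. k \<in> {1..K} \<Longrightarrow> measure M {\<omega> \<in> space M. Y \<omega> = k} = 1 / real K"
    and int: "\<And>k. k \<in> {1..K} \<Longrightarrow> integrable M (station k)"
  shows "integrable M (\<lambda>\<omega>. station (Y \<omega>) \<omega>)"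
    and "expectation (\<lambda>\<omega>. station (Y \<omega>) \<omega>) = (\<Sum>k = 1..K. expectation (station k)) / real K"
proof -
  note Y_meas [measurable]
  \<comment> \<open>Each summand is a function of a pair, so that \<open>indep_integral\<close>
    applies with \<open>Y\<close> as the fresh variable under its own law.\<close>
  define h where "h k = (\<lambda>p :: real \<times> nat. fst p * indicator {k} (snd p))" for k
  let ?Y = "distr M (count_space {1..K}) Y"
  have h [measurable]: "h k \<in> borel_measurable (borel \<Otimes>\<^sub>M ?Y)" for k
  proof -
    have "indicator {k} \<in> borel_measurable ?Y" by simp
    then show ?thesis unfolding h_def
      by (intro borel_measurable_times measurable_fst measurable_compose[OF measurable_snd])
  qed
  interpret Yd: prob_space ?Y by (rule prob_space_distr[OF Y_meas])
  have term_int: "integrable M (\<lambda>\<omega>. h k (station k \<omega>, Y \<omega>))"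
    and term_eq: "expectation (\<lambda>\<omega>. h k (station k \<omega>, Y \<omega>)) = expectation (station k) / real K"
    if k: "k \<in> {1..K}" for k
  proof -
    note [measurable] = station_meas[OF k]
    have YM: "Y \<in> measurable M ?Y" using Y_meas by simp
    show *: "integrable M (\<lambda>\<omega>. h k (station k \<omega>, Y \<omega>))"
    proof (rule Bochner_Integration.integrable_bound[OF int[OF k]])
      show "(\<lambda>\<omega>. h k (station k \<omega>, Y \<omega>)) \<in> borel_measurable M"
        using measurable_compose[OF measurable_Pair[OF station_meas[OF k] YM] h] by simp
    qed (auto simp: h_def indicator_def)
    have "distr M (borel \<Otimes>\<^sub>M ?Y) (\<lambda>\<omega>. (station k \<omega>, Y \<omega>)) = distr M borel (station k) \<Otimes>\<^sub>M distr M ?Y Y"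
    proof (rule indep_sets_distr_pair[OF indep[folded gen_def bsize_def] gen_stable past_sources[OF order_refl]])
      show "Output \<in> sources K bsize" "Output \<notin> past (K + 1)" by (auto simp: sources_def past_def)
      show "station k \<in> sigma (space M) (\<Union> (gen ` past (K + 1))) \<rightarrow>\<^sub>M borel"
        using station_info[OF k] by (simp add: info_def)
      show "Y -` A \<inter> space M \<in> gen Output" if "A \<in> sets ?Y" for A
        using that by (auto intro!: in_vimage_algebra simp: gen_def source_events_def)
    qed (rule YM)
    moreover have "distr M ?Y Y = ?Y" by (intro distr_cong) auto
    ultimately have "expectation (\<lambda>\<omega>. h k (station k \<omega>, Y \<omega>))
        = (\<integral>\<omega>. (\<integral>y. h k (station k \<omega>, y) \<partial>?Y) \<partial>M)"
      using indep_integral[OF station_meas[OF k] YM _ Yd.prob_space_axioms h *] by simp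
    also have "\<dots> = (\<integral>\<omega>. station k \<omega> / real K \<partial>M)"
    proof (rule Bochner_Integration.integral_cong[OF refl])
      fix \<omega>
      have "measure ?Y {k} = 1 / real K"
        using Y_law[OF k] k by (subst measure_distr[OF Y_meas]) (auto simp: vimage_def Int_def conj_commute)
      then show "(\<integral>y. h k (station k \<omega>, y) \<partial>?Y) = station k \<omega> / real K" using k by (simp add: h_def)
    qed
    finally show "expectation (\<lambda>\<omega>. h k (station k \<omega>, Y \<omega>)) = expectation (station k) / real K" by simp
  qed
  have eq: "station (Y \<omega>) \<omega> = (\<Sum>k = 1..K. h k (station k \<omega>, Y \<omega>))" if "\<omega> \<in> space M" for \<omega>
  proof -
    have "Y \<omega> \<in> {1..K}" using measurable_space[OF Y_meas that] by simp
    then have "(\<Sum>k = 1..K. h k (station k \<omega>, Y \<omega>)) = (\<Sum>k = 1..K. if k = Y \<omega> then station k \<omega> else 0)"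
      by (intro sum.cong) (auto simp: h_def indicator_def)
    then show ?thesis using \<open>Y \<omega> \<in> {1..K}\<close> by simp
  qed
  have "integrable M (\<lambda>\<omega>. \<Sum>k = 1..K. h k (station k \<omega>, Y \<omega>))"
    by (intro Bochner_Integration.integrable_sum term_int)
  then show "integrable M (\<lambda>\<omega>. station (Y \<omega>) \<omega>)"
    by (rule Bochner_Integration.integrable_cong[THEN iffD2, rotated 2]) (simp_all only: eq)
  have "expectation (\<lambda>\<omega>. station (Y \<omega>) \<omega>) = expectation (\<lambda>\<omega>. \<Sum>k = 1..K. h k (station k \<omega>, Y \<omega>))"
    by (intro Bochner_Integration.integral_cong refl eq)
  also have "\<dots> = (\<Sum>k = 1..K. expectation (station k) / real K)"
    by (subst Bochner_Integration.integral_sum) (auto intro: term_int simp: term_eq)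
  finally show "expectation (\<lambda>\<omega>. station (Y \<omega>) \<omega>) = (\<Sum>k = 1..K. expectation (station k)) / real K"
    by (simp add: sum_divide_distrib)
qed

lemma station_bound:
  assumes dim: "CARD('n) \<ge> 2" and K: "K > 0" and t: "t > 0"
    and lower: "\<And>y. y \<in> X \<Longrightarrow> flow \<le> f y"
    and start: "integrable M (\<lambda>\<omega>. f (x 1 \<omega>))"
    and Y_law: "\<And>k. k \<in> {1..K} \<Longrightarrow> measure M {\<omega> \<in> space M. Y \<omega> = k} = 1 / real K"
  defines "\<Delta>f \<equiv> expectation (\<lambda>\<omega>. f (x 1 \<omega>)) - flow"
    and "\<Omega> \<equiv> (exp 1)\<^sup>2 * ln (real CARD('n))"
  shows "integrable M (\<lambda>\<omega>. station (Y \<omega>) \<omega>)"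
    and "expectation (\<lambda>\<omega>. station (Y \<omega>) \<omega>)
      \<le> (L + 1 / \<eta> + sqrt (4 * \<Omega>\<^sup>2 * L\<^sup>2 * real q0 / real m)) * \<psi>
        + sqrt (\<Omega>\<^sup>2 * \<sigma>sq / real m1)
        + 1 / \<psi> * (\<Delta>f / real K + t * \<Omega>\<^sup>2 * \<sigma>sq / (2 * real m1)
            + (2 * t * \<Omega>\<^sup>2 * L\<^sup>2 * real q0 / real m + L / 2 + 1 / (2 * t)) * \<psi>\<^sup>2)"
proof -
  define S where "S = \<Omega>\<^sup>2 * \<sigma>sq / real m1 + 4 * \<Omega>\<^sup>2 * L\<^sup>2 * real q0 / real m * \<psi>\<^sup>2"
  define a where "a k = expectation (\<lambda>\<omega>. f (x k \<omega>))" for k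
  define R where "R = (L / 2 + 1 / (2 * t)) * \<psi>\<^sup>2 + t * S / 2"
  define C where "C = L * \<psi> + \<psi> / \<eta> + sqrt S"
  have S: "expectation (\<lambda>\<omega>. (infnorm (err k \<omega>))\<^sup>2) \<le> S" if "k \<in> {1..K}" for k
    using err_second_moment(2)[OF dim that] by (simp add: S_def \<Omega>_def)
  have stat: "integrable M (station k)" "expectation (station k) \<le> C + (a k - a (Suc k) + R) / \<psi>"
    if "k \<in> {1..K}" for k
    using station_expectation[OF dim lower start t that S[OF that]] by (auto simp: C_def R_def a_def add.assoc)
  show "integrable M (\<lambda>\<omega>. station (Y \<omega>) \<omega>)"
    by (rule station_random_index(1)[OF Y_law stat(1)])
  \<comment> \<open>The telescoped sum ends at \<open>x (K + 1)\<close>, which is still in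
    \<open>X\<close>.\<close>
  have "a (K + 1) \<ge> flow"
  proof -
    have "expectation (\<lambda>\<omega>. flow) \<le> a (K + 1)"
      unfolding a_def using x_in[of "K + 1"] f_integrable[OF dim lower start, of "K + 1"]
      by (intro integral_mono_AE) (auto intro!: lower)
    then show ?thesis by (simp add: prob_space)
  qed
  have tele: "(\<Sum>k = 1..K. a k - a (Suc k)) = a 1 - a (K + 1)"
    using sum_telescope[of a K] sum_Suc_diff'[of 1 "Suc K" a] K
    by (simp add: sum_subtractf atLeastLessThanSuc_atLeastAtMost[symmetric])
  have "expectation (\<lambda>\<omega>. station (Y \<omega>) \<omega>) = (\<Sum>k = 1..K. expectation (station k)) / real K"
    by (rule station_random_index(2)[OF Y_law stat(1)])
  also have "\<dots> \<le> (\<Sum>k = 1..K. C + (a k - a (Suc k) + R) / \<psi>) / real K"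
    using stat(2) by (intro divide_right_mono sum_mono) auto
  also have "(\<Sum>k = 1..K. C + (a k - a (Suc k) + R) / \<psi>)
      = real K * C + ((\<Sum>k = 1..K. a k - a (Suc k)) + real K * R) / \<psi>"
    by (simp add: sum.distrib flip: sum_divide_distrib)
  also have "\<dots> / real K = C + 1 / \<psi> * ((a 1 - a (K + 1)) / real K + R)"
    unfolding tele using K pos by (simp add: field_simps)
  also have "\<dots> \<le> C + 1 / \<psi> * (\<Delta>f / real K + R)"
    using \<open>a (K + 1) \<ge> flow\<close> pos K
    by (intro add_left_mono mult_left_mono add_right_mono divide_right_mono) (auto simp: \<Delta>f_def a_def)
  \<comment> \<open>Subadditivity of the square root separates the sampling noise of the restarts
    from the part proportional to \<psi>.\<close>
  also have "C \<le> (L + 1 / \<eta> + sqrt (4 * \<Omega>\<^sup>2 * L\<^sup>2 * real q0 / real m)) * \<psi> + sqrt (\<Omega>\<^sup>2 * \<sigma>sq / real m1)"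
  proof -
    have "sqrt S \<le> sqrt (\<Omega>\<^sup>2 * \<sigma>sq / real m1) + sqrt (4 * \<Omega>\<^sup>2 * L\<^sup>2 * real q0 / real m * \<psi>\<^sup>2)"
      unfolding S_def using \<sigma>sq by (intro sqrt_add_le_add_sqrt) auto
    also have "sqrt (4 * \<Omega>\<^sup>2 * L\<^sup>2 * real q0 / real m * \<psi>\<^sup>2) = sqrt (4 * \<Omega>\<^sup>2 * L\<^sup>2 * real q0 / real m) * \<psi>"
      using pos by (simp only: real_sqrt_mult) simp
    finally show ?thesis by (simp add: C_def algebra_simps)
  qed
  also have "\<Delta>f / real K + R = \<Delta>f / real K + t * \<Omega>\<^sup>2 * \<sigma>sq / (2 * real m1)
      + (2 * t * \<Omega>\<^sup>2 * L\<^sup>2 * real q0 / real m + L / 2 + 1 / (2 * t)) * \<psi>\<^sup>2"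
  proof -
    have "t * S / 2 = t * \<Omega>\<^sup>2 * \<sigma>sq / (2 * real m1) + 2 * t * \<Omega>\<^sup>2 * L\<^sup>2 * real q0 / real m * \<psi>\<^sup>2"
      using pos by (simp add: S_def field_simps)
    then show ?thesis unfolding R_def by (simp only: distrib_right)
  qed
  finally show "expectation (\<lambda>\<omega>. station (Y \<omega>) \<omega>)
      \<le> (L + 1 / \<eta> + sqrt (4 * \<Omega>\<^sup>2 * L\<^sup>2 * real q0 / real m)) * \<psi>
        + sqrt (\<Omega>\<^sup>2 * \<sigma>sq / real m1)
        + 1 / \<psi> * (\<Delta>f / real K + t * \<Omega>\<^sup>2 * \<sigma>sq / (2 * real m1)
            + (2 * t * \<Omega>\<^sup>2 * L\<^sup>2 * real q0 / real m + L / 2 + 1 / (2 * t)) * \<psi>\<^sup>2)"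
    by simp
qed

end

section \<open>Main theorem\<close>

theorem theorem4:
  fixes X :: "(real^'n) set"
    and D :: "'z measure"
    and F :: "real^'n \<Rightarrow> 'z \<Rightarrow> real"
    and f :: "real^'n \<Rightarrow> real"
    and M :: "'w measure"
    and x G :: "nat \<Rightarrow> 'w \<Rightarrow> real^'n"
    and \<zeta> :: "nat \<Rightarrow> nat \<Rightarrow> 'w \<Rightarrow> 'z"
    and Y :: "'w \<Rightarrow> nat"
    and K q0 m1 m :: nat
    and L flow \<psi> \<eta> t \<sigma>sq \<Omega> \<Delta>f :: real
  assumes dim: "CARD('n) \<ge> 2"
    and X: "X \<noteq> {}" "closed X" "convex X"
    \<comment> \<open>\<open>D\<close> is the law of the random vector, on the sample space \<open>space D\<close>\<close>
    and D: "prob_space D"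
    and F_integrable: "\<And>y. integrable D (F y)"
    and f_eq: "\<And>y. f y = (\<integral>z. F y z \<partial>D)"
    and f_diff: "\<And>y. f differentiable (at y)"
    and F_diff: "\<And>y z. z \<in> space D \<Longrightarrow> (\<lambda>u. F u z) differentiable (at y)"
    and unbiased: "\<And>y. y \<in> X \<Longrightarrow>
      has_bochner_integral D (\<lambda>z. grad (\<lambda>u. F u z) y) (grad f y)"
    and var_integrable: "\<And>y. y \<in> X \<Longrightarrow>
      integrable D (\<lambda>z. (infnorm (grad (\<lambda>u. F u z) y - grad f y))\<^sup>2)"
    and var_bdd: "bdd_above ((\<lambda>y. \<integral>z. (infnorm (grad (\<lambda>u. F u z) y - grad f y))\<^sup>2 \<partial>D) ` X)"
    and var_def: "\<sigma>sq = (SUP y\<in>X. \<integral>z. (infnorm (grad (\<lambda>u. F u z) y - grad f y))\<^sup>2 \<partial>D)"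
    and L_nonneg: "L \<ge> 0"
    and mean_lipschitz: "\<And>y y'. y \<in> X \<Longrightarrow> y' \<in> X \<Longrightarrow>
      integrable D (\<lambda>z. (infnorm (grad (\<lambda>u. F u z) y - grad (\<lambda>u. F u z) y'))\<^sup>2) \<and>
      (\<integral>z. (infnorm (grad (\<lambda>u. F u z) y - grad (\<lambda>u. F u z) y'))\<^sup>2 \<partial>D)
        \<le> L\<^sup>2 * (l1norm (y - y'))\<^sup>2"
    and lower: "\<And>y. y \<in> X \<Longrightarrow> flow \<le> f y"
    and pos: "K > 0" "q0 > 0" "m1 > 0" "m > 0" "\<psi> > 0" "\<eta> > 0" "t > 0"
    and M: "prob_space M"
    and start_meas: "x 1 \<in> borel_measurable M"
    and start_in: "\<And>\<omega>. \<omega> \<in> space M \<Longrightarrow> x 1 \<omega> \<in> X"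
    and start_integrable: "integrable M (\<lambda>\<omega>. f (x 1 \<omega>))"
    and sample_meas: "\<And>k i. k \<in> {1..K} \<Longrightarrow> i \<in> {1..batch q0 m1 m k} \<Longrightarrow> \<zeta> k i \<in> measurable M D"
    and sample_law: "\<And>k i. k \<in> {1..K} \<Longrightarrow> i \<in> {1..batch q0 m1 m k} \<Longrightarrow> distr M D (\<zeta> k i) = D"
    and Y_meas: "Y \<in> measurable M (count_space {1..K})"
    and Y_law: "\<And>k. k \<in> {1..K} \<Longrightarrow> measure M {\<omega> \<in> space M. Y \<omega> = k} = 1 / real K"
    and indep: "prob_space.indep_sets M (source_events M D K (x 1) \<zeta> Y) (sources K (batch q0 m1 m))"
    and estimate: "\<And>k \<omega>. k \<in> {1..K} \<Longrightarrow> \<omega> \<in> space M \<Longrightarrow>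
      G k \<omega> =
        (if [k = 1] (mod q0)
         then (1 / real (batch q0 m1 m k)) *\<^sub>R
                (\<Sum>i = 1..batch q0 m1 m k. grad (\<lambda>u. F u (\<zeta> k i \<omega>)) (x k \<omega>))
         else (1 / real (batch q0 m1 m k)) *\<^sub>R
                (\<Sum>i = 1..batch q0 m1 m k.
                   grad (\<lambda>u. F u (\<zeta> k i \<omega>)) (x k \<omega>) - grad (\<lambda>u. F u (\<zeta> k i \<omega>)) (x (k - 1) \<omega>))
              + G (k - 1) \<omega>)"
    and update: "\<And>k \<omega>. k \<in> {1..K} \<Longrightarrow> \<omega> \<in> space M \<Longrightarrow>
      prox_step X (delta {z. l1norm z \<le> \<psi>}) \<eta> (x k \<omega>) (G k \<omega>) (x (k + 1) \<omega>)"
    and Delta_def: "\<Delta>f = (\<integral>\<omega>. f (x 1 \<omega>) \<partial>M) - flow"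
    and Omega_def: "\<Omega> = (exp 1)\<^sup>2 * ln (real CARD('n))"
  shows "integrable M
           (\<lambda>\<omega>. dist0_infnorm (frechet_subdiff (\<lambda>y. ereal (f y) + delta X y) (x (Y \<omega> + 1) \<omega>)))
       \<and> (\<integral>\<omega>. dist0_infnorm (frechet_subdiff (\<lambda>y. ereal (f y) + delta X y) (x (Y \<omega> + 1) \<omega>)) \<partial>M)
           \<le> (L + 1 / \<eta> + sqrt (4 * \<Omega>\<^sup>2 * L\<^sup>2 * real q0 / real m)) * \<psi>
             + sqrt (\<Omega> * (exp 1)\<^sup>2 * ln (real CARD('n)) * \<sigma>sq / real m1)
             + 1 / \<psi> * (\<Delta>f / real K
                 + t * \<Omega> * (exp 1)\<^sup>2 * ln (real CARD('n)) * \<sigma>sq / (2 * real m1)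
                 + (2 * t * \<Omega>\<^sup>2 * L\<^sup>2 * real q0 / real m + L / 2 + 1 / (2 * t)) * \<psi>\<^sup>2)"
proof -
  interpret prob_space M by (rule M)
  interpret D: prob_space D by (rule D)
  have var_le: "(\<integral>z. (infnorm (grad (\<lambda>u. F u z) y - grad f y))\<^sup>2 \<partial>D) \<le> \<sigma>sq" if "y \<in> X" for y
    unfolding var_def by (rule cSUP_upper[OF that var_bdd])
  have "\<sigma>sq \<ge> 0"
  proof -
    obtain y where "y \<in> X" using X by blast
    have "0 \<le> (\<integral>z. (infnorm (grad (\<lambda>u. F u z) y - grad f y))\<^sup>2 \<partial>D)" by simp
    also have "\<dots> \<le> \<sigma>sq" using \<open>y \<in> X\<close> by (rule var_le)
    finally show ?thesis .
  qed
  have F_meas: "F y \<in> borel_measurable D" for y using F_integrable by auto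
  interpret run: variance_reduced_run M D X F f x G \<zeta> Y K q0 m1 m L \<psi> \<eta> \<sigma>sq
    by (unfold_locales; fact X F_meas F_diff f_diff unbiased var_integrable var_le \<open>\<sigma>sq \<ge> 0\<close> L_nonneg
        mean_lipschitz pos start_meas start_in sample_meas sample_law Y_meas indep estimate update)
  \<comment> \<open>The statement spells out one of the two factors \<Omega> of its square.\<close>
  have sq: "\<Omega> * (exp 1)\<^sup>2 * ln (real CARD('n)) = \<Omega>\<^sup>2" "t * \<Omega> * (exp 1)\<^sup>2 * ln (real CARD('n)) = t * \<Omega>\<^sup>2"
    by (simp_all add: Omega_def power2_eq_square)
  show ?thesis
    unfolding sq
    using run.station_bound[OF dim pos(1,7) lower start_integrable Y_law]
    unfolding run.station_def Omega_def[symmetric] Delta_def[symmetric] by blast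
qed

end
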